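(* Let $X_1,\dots,X_n$ be independent random variables taking values in a measurable space $\mathcal{X}$, and let $Z=F(X_1,\dots,X_n)$ be integrable, for some measurable function $F:\mathcal{X}^n\to\mathbb{R}$. Let $\mathcal{F}_i=\sigma(X_1,\dots,X_i)$ for $1\le i\le n$ and let $\mathcal{F}_0$ be the trivial $\sigma$-field. For $1\le i\le n$, let \[ Z_i=F(X_1,\dots,X_{i-1},X_i',X_{i+1},\dots,X_n),\qquad \Delta_i:=Z-Z_i, \] where $X_i'$ is an independent copy of $X_i$, independent of $X_1,\dots,X_n$. Suppose that for each $1\le i\le n$ there are integrable real random variables $T_i,W_i$ with $T_i\preceq_0 W_i$ such that, almost surely, \[ \mathbb{E}[(\Delta_i-t)_+\mid\mathcal{F}_{i-1}]\le\mathbb{E}[(W_i-t)_+]\quad\text{and}\quad \mathbb{E}[(t-\Delta_i)_+\mid\mathcal{F}_{i-1}]\le\mathbb{E}[(t-T_i)_+]\quad\text{for all } t\in\mathbb{R}. \] Then, with $\xi_{T_1,W_1},\dots,\xi_{T_n,W_n}$ mutually independent (each $\xi_{T_i,W_i}$ having the distribution defined in the context), \[ \mathbb{E}[(Z-\mathbb{E}[Z]-t)_+]\le\mathbb{E}\left[\left(\sum_{i=1}^n\xi_{T_i,W_i}-t\right)_+\right]\quad\text{for all } t\in\mathbb{R}. \] Consequently, for all $x\in\mathbb{R}$, \[ \mathbb{P}(Z-\mathbb{E}[Z]\ge x)\le\inf_{\lambda\ge 0}\mathbb{E}\left[\left(1+\lambda\left(\sum_{i=1}^n\xi_{T_i,W_i}-x\right)\right)_+\right].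 \]
   Context: Notation: $u_+=\max\{u,0\}$. For real random variables $U,V$, $U\preceq_0 V$ means $\mathbb{P}(U>t)\le\mathbb{P}(V>t)$ for all $t\in\mathbb{R}$. Definition of $\xi_{T,W}$: let $T,W$ be integrable real random variables with $T\preceq_0 W$ and $\mathbb{E}[T]\le 0\le\mathbb{E}[W]$ (the latter holds for $T=T_i$, $W=W_i$ under the hypotheses of the claim). For $q\in[0,1]$ let $a_q:=\inf\{x:\mathbb{P}(T\le x)\ge 1-q\}$ and $b_q:=\inf\{x:\mathbb{P}(W\le x)\ge 1-q\}$ (values $\pm\infty$ allowed), and let $\xi_q$ be a random variable with distribution function \[ \mathbb{P}(\xi_q\le x)=\begin{cases}\mathbb{P}(T\le x), & x<a_q,\\ 1-q, & a_q\le x<b_q,\\ \mathbb{P}(W\le x), & x\ge b_q.\end{cases} \] Let $q_0$ be the largest $q\in[0,1]$ with $\mathbb{E}[\xi_{q}]=0$ (such a $q$ exists). Then $\xi_{T,W}$ denotes a random variable with the distribution of $\xi_{q_0}$; it depends on $T$ and $W$ only through their distributions. *)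

theory Defs
  imports "HOL-Probability.Probability"
begin

(* The sigma-field generated by (X j), j \<in> J; it is trivial for J = {}. *)
definition generated_sigma ::
    "'a measure \<Rightarrow> 'x measure \<Rightarrow> (nat \<Rightarrow> 'a \<Rightarrow> 'x) \<Rightarrow> nat set \<Rightarrow> 'a measure" where
  "generated_sigma M S X J =
     sigma (space M) (\<Union>j\<in>J. {X j -` A \<inter> space M | A. A \<in> sets S})"

(* The usual stochastic order; only the laws matter, so U and V may live on different spaces. *)
definition stoch_le ::
    "'c measure \<Rightarrow> ('c \<Rightarrow> real) \<Rightarrow> 'd measure \<Rightarrow> ('d \<Rightarrow> real) \<Rightarrow> bool" where
  "stoch_le P U Q V \<longleftrightarrow>
     (\<forall>t. measure P {\<omega>\<in>space P. U \<omega> > t} \<le> measure Q {\<omega>\<in>space Q. V \<omega> > t})"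

(* Extended-real valued: Inf {} = \<infinity> and Inf (range ereal) = -\<infinity>. *)
definition upper_quantile :: "real measure \<Rightarrow> real \<Rightarrow> ereal" where
  "upper_quantile \<mu> q = Inf {ereal x | x. cdf \<mu> x \<ge> 1 - q}"

(* Here and below, \<mu> and \<nu> are the laws of T and W. *)
definition xi_cdf :: "real measure \<Rightarrow> real measure \<Rightarrow> real \<Rightarrow> real \<Rightarrow> real" where
  "xi_cdf \<mu> \<nu> q x =
     (if ereal x < upper_quantile \<mu> q then cdf \<mu> x
      else if ereal x < upper_quantile \<nu> q then 1 - q
      else cdf \<nu> x)"

(* interval_measure G is the Borel measure giving each interval {a<..b} mass G b - G a,
   hence the law with distribution function G. *)
definition xi_dist :: "real measure \<Rightarrow> real measure \<Rightarrow> real \<Rightarrow> real measure" where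
  "xi_dist \<mu> \<nu> q = interval_measure (xi_cdf \<mu> \<nu> q)"

(* has_bochner_integral rather than an equation for the Bochner integral, which would also
   hold for a non-integrable identity function. *)
definition xi_level :: "real measure \<Rightarrow> real measure \<Rightarrow> real" where
  "xi_level \<mu> \<nu> =
     (GREATEST q. 0 \<le> q \<and> q \<le> 1 \<and> has_bochner_integral (xi_dist \<mu> \<nu> q) (\<lambda>x. x) 0)"

definition xi_law :: "real measure \<Rightarrow> real measure \<Rightarrow> real measure" where
  "xi_law \<mu> \<nu> = xi_dist \<mu> \<nu> (xi_level \<mu> \<nu>)"

end

theory Submission
  imports Defs
begin

text \<open>Write \<open>Z - E Z\<close> as the sum of the martingale differences
  \<open>D\<^sub>k = E[Z | \<F>\<^sub>k] - E[Z | \<F>\<^sub>k\<^sub>-\<^sub>1] = E[\<Delta>\<^sub>k | \<F>\<^sub>k]\<close>. By conditional Jensen the two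
  bounds on \<open>\<Delta>\<^sub>k\<close> pass to \<open>D\<^sub>k\<close>. Since \<open>D\<^sub>k\<close> has conditional mean zero, its
  integrated tail \<open>f\<close> is convex with \<open>f s \<le> E(W\<^sub>k - s)\<^sub>+\<close> and \<open>f s + s \<le> E(s - T\<^sub>k)\<^sub>+\<close>. The
  integrated tail of \<open>\<xi>\<^sub>k\<close> equals the first bound above \<open>b\<^sub>q\<close>, the second below
  \<open>a\<^sub>q\<close>, and is affine in between, so it dominates \<open>f\<close>. The differences are then
  replaced one at a time by independent \<open>\<xi>\<^sub>k\<close>. Regular conditional distributions are avoided by
  stating conditional inequalities as integrals over events of the past and approximating
  \<open>E[Z | \<F>\<^sub>k\<^sub>-\<^sub>1]\<close> by simple functions.\<close>

section \<open>The spliced law\<close>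

text \<open>The definition of \<xi> by cases on possibly infinite quantiles is awkward to integrate.
  On (0,1) it becomes one random variable: the quantile of T for u \<le> 1 - q and that of W for u >
  1 - q. As q runs from 0 to 1, its mean moves continuously from E T to E W. These two have the
  required signs because the bounds on the centred \<open>\<Delta>\<^sub>k\<close> persist as the
  level tends to -\<infinity> or \<infinity>. Hence a level with mean zero exists. Each conditional
  bound holds almost surely at a fixed level, but adding \<open>D\<^sub>k\<close> to the earlier
  differences calls for the random level
  \<open>t - (E[Z | \<F>\<^sub>k\<^sub>-\<^sub>1] - E Z)\<close>. Integrals over past events avoid
  an uncountable union of null sets. Z and the \<xi> variables live on different probability spaces
  and are never coupled: only the function \<open>s \<mapsto> E(\<xi>\<^sub>k - s)\<^sub>+\<close>
  passes from one space to the other.\<close>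

definition quantile :: "real measure \<Rightarrow> real \<Rightarrow> real" where
  "quantile \<mu> u = Inf {x. u \<le> cdf \<mu> x}"

text \<open>Open at both ends: for 0 < u < 1 the set \<open>{x. u \<le> cdf \<mu> x}\<close> is
  nonempty and bounded below for every law, so that its \<open>Inf\<close> is meaningful.\<close>

abbreviation unit_uniform :: "real measure" where
  "unit_uniform \<equiv> restrict_space lborel {0<..<1}"

text \<open>Here \<open>r\<close> stands for 1 - q. The point where the two branches meet carries no
  mass, so the choice of branch at \<open>u = r\<close> is immaterial.\<close>

definition spliced_quantile :: "real measure \<Rightarrow> real measure \<Rightarrow> real \<Rightarrow> real \<Rightarrow> real" where
  "spliced_quantile \<mu> \<nu> r u = (if u \<le> r then quantile \<mu> u else quantile \<nu> u)"

lemma prob_space_unit_uniform: "prob_space unit_uniform"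
  by (auto simp: emeasure_restrict_space space_restrict_space intro!: prob_spaceI)

lemma space_unit_uniform: "space unit_uniform = {0<..<1}"
  by (simp add: space_restrict_space)

section \<open>Quantile functions as random variables on the unit interval\<close>

text \<open>Right-continuity of the distribution function makes the infimum attained. This Galois
  connection is the source of the order properties of quantiles below.\<close>

lemma (in real_distribution) quantile_le_iff:
  assumes "0 < u" "u < 1" shows "quantile M u \<le> x \<longleftrightarrow> u \<le> cdf M x"
proof -
  interpret cdf_distribution M by unfold_locales
  show ?thesis unfolding quantile_def using pseudoinverse[OF assms] by blast
qed

lemma (in real_distribution) measurable_quantile [measurable]:
  "quantile M \<in> borel_measurable unit_uniform"
proof -
  interpret cdf_distribution M by unfold_locales
  have "quantile M \<in> borel_measurable (restrict_space borel {0<..<1})"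
    using measurable_CI by (simp add: quantile_def[abs_def])
  then show ?thesis
    by (simp cong: measurable_cong_sets add: sets_restrict_space)
qed

text \<open>Inverse-transform sampling: integrals against the laws of T and W become integrals over
  the same space on which the splice lives.\<close>

lemma (in real_distribution) distr_quantile: "distr unit_uniform borel (quantile M) = M"
proof -
  interpret cdf_distribution M by unfold_locales
  show ?thesis using distr_I_eq_M by (simp add: quantile_def[abs_def])
qed

lemma (in real_distribution) quantile_mono:
  assumes "0 < u" "u \<le> v" "v < 1" shows "quantile M u \<le> quantile M v"
proof -
  have "v \<le> cdf M (quantile M v)" using quantile_le_iff[of v "quantile M v"] assms by simp
  then show ?thesis using assms by (subst quantile_le_iff) auto
qed

lemma measure_unit_uniform_le:
  assumes "0 \<le> c" "c \<le> 1"
  shows "measure unit_uniform ({u. u \<le> c} \<inter> {0<..<1}) = c"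
proof (cases "c = 1")
  case True
  have "{u. u \<le> c} \<inter> {0<..<1} = {0<..<1}" using True by auto
  then show ?thesis using True by (simp add: measure_restrict_space)
next
  case False
  have "{u. u \<le> c} \<inter> {0<..<1} = {0<..c}" using False assms by auto
  moreover have "{0<..c} \<subseteq> {0<..<1}" using False assms by auto
  ultimately show ?thesis using assms by (simp add: measure_restrict_space)
qed

section \<open>Law, mean and level of the splice\<close>

text \<open>The stochastic order is expressed by distribution functions, which reverses the
  inequality. The two mean conditions are derived later from the conditional bounds, before the
  locale is used.\<close>

locale stoch_pair = \<mu>: real_distribution \<mu> + \<nu>: real_distribution \<nu> for \<mu> \<nu> +
  assumes cdf_le: "\<And>x. cdf \<nu> x \<le> cdf \<mu> x"
    and integrable_\<mu>: "integrable \<mu> (\<lambda>x. x)" and integrable_\<nu>: "integrable \<nu> (\<lambda>x. x)"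
    and mean_\<mu>: "(\<integral>x. x \<partial>\<mu>) \<le> 0" and mean_\<nu>: "0 \<le> (\<integral>x. x \<partial>\<nu>)"
begin

sublocale U: prob_space unit_uniform by (rule prob_space_unit_uniform)

lemma measurable_splice [measurable]: "spliced_quantile \<mu> \<nu> r \<in> borel_measurable unit_uniform"
proof -
  have "{u \<in> {0<..<1}. u \<le> r} = {..r} \<inter> {0<..<1}"
    by auto
  then have "{u \<in> space unit_uniform. u \<le> r} \<in> sets unit_uniform"
    by (simp only: space_unit_uniform) (simp add: sets_restrict_space_iff)
  then show ?thesis
    unfolding spliced_quantile_def
    by (intro measurable_If \<mu>.measurable_quantile \<nu>.measurable_quantile)
qed

lemma quantile_le_quantile:
  assumes "0 < u" "u < 1" shows "quantile \<mu> u \<le> quantile \<nu> u"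
proof -
  have "u \<le> cdf \<nu> (quantile \<nu> u)" using \<nu>.quantile_le_iff[of u "quantile \<nu> u"] assms by simp
  then have "u \<le> cdf \<mu> (quantile \<nu> u)" using cdf_le order_trans by blast
  then show ?thesis using assms by (subst \<mu>.quantile_le_iff) auto
qed

text \<open>Being below the upper quantile at \<open>q\<close> amounts to having \<open>cdf\<close>
  below 1 - q. Since \<open>cdf \<nu> x \<le> cdf \<mu> x\<close>, the minimum and the maximum then
  select the right one of the three cases, and infinite quantiles disappear.\<close>

lemma xi_cdf_eq:
  assumes q: "0 \<le> q" "q \<le> 1"
  shows "xi_cdf \<mu> \<nu> q x = min (1 - q) (cdf \<mu> x) + max 0 (cdf \<nu> x - (1 - q))"
proof -
  have less: "cdf m x < 1 - q" if "ereal x < upper_quantile m q" for m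
  proof (rule ccontr)
    assume "\<not> cdf m x < 1 - q"
    then have "ereal x \<in> {ereal x | x. cdf m x \<ge> 1 - q}" by auto
    then have "upper_quantile m q \<le> ereal x" unfolding upper_quantile_def by (rule Inf_lower)
    with that show False by simp
  qed
  have ge: "1 - q \<le> cdf m x" if "\<not> ereal x < upper_quantile m q" "real_distribution m" for m
  proof -
    interpret m: real_distribution m by fact
    have "1 - q \<le> cdf m y" if "x < y" for y
    proof -
      have "upper_quantile m q < ereal y"
        using \<open>\<not> ereal x < _\<close> that
        by (metis ereal_less_eq(3) le_less_trans less_ereal.simps(1) not_less)
      then obtain z where "1 - q \<le> cdf m z" "z < y"
        unfolding upper_quantile_def Inf_less_iff by auto
      then show ?thesis using m.cdf_nondecreasing[of z y] by linarith
    qed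
    \<comment> \<open>The infimum gives the inequality only strictly to the right of
      \<open>x\<close>; right-continuity carries it to \<open>x\<close> itself.\<close>
    then have "eventually (\<lambda>y. 1 - q \<le> cdf m y) (at_right x)"
      by (auto simp: eventually_at_filter)
    then show ?thesis
      using m.cdf_is_right_cont[of x]
      by (intro tendsto_lowerbound[where F="at_right x" and f="cdf m"])
         (auto simp: continuous_within)
  qed
  show ?thesis
    using less[of \<mu>] less[of \<nu>] ge[of \<mu>] ge[of \<nu>] cdf_le[of x]
      \<mu>.real_distribution_axioms \<nu>.real_distribution_axioms
    unfolding xi_cdf_def by (auto simp: min_def max_def)
qed

text \<open>The event that the splice is at most \<open>x\<close> is cut at \<open>u = r\<close>:
  below the cut it is \<open>u \<le> cdf \<mu> x\<close>, above it
  \<open>u \<le> cdf \<nu> x\<close>.\<close>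

lemma cdf_splice:
  assumes "0 \<le> r" "r \<le> 1"
  shows "cdf (distr unit_uniform borel (spliced_quantile \<mu> \<nu> r)) x
           = min r (cdf \<mu> x) + max 0 (cdf \<nu> x - r)"
proof -
  let ?A = "{u. u \<le> min r (cdf \<mu> x)} \<inter> {0<..<1}"
  \<comment> \<open>The maximum with \<open>r\<close> makes this a difference of nested intervals
    even when \<open>cdf \<nu> x < r\<close>, where it is empty.\<close>
  let ?B = "{u. u \<le> max r (cdf \<nu> x)} \<inter> {0<..<1} - {u. u \<le> r} \<inter> {0<..<1}"
  have *: "u \<in> ?A \<union> ?B \<longleftrightarrow> spliced_quantile \<mu> \<nu> r u \<le> x \<and> u \<in> {0<..<1}" for u
    using \<mu>.quantile_le_iff[of u x] \<nu>.quantile_le_iff[of u x]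
    by (auto simp: spliced_quantile_def max_def)
  then have vimage: "spliced_quantile \<mu> \<nu> r -` {..x} \<inter> space unit_uniform = ?A \<union> ?B"
    unfolding set_eq_iff space_unit_uniform by simp
  have [measurable]: "?A \<in> sets unit_uniform" "?B \<in> sets unit_uniform"
    "{u. u \<le> max r (cdf \<nu> x)} \<inter> {0<..<1} \<in> sets unit_uniform"
    "{u. u \<le> r} \<inter> {0<..<1} \<in> sets unit_uniform"
    by (auto simp: sets_restrict_space_iff)
  have "cdf (distr unit_uniform borel (spliced_quantile \<mu> \<nu> r)) x = U.prob (?A \<union> ?B)"
    unfolding vimage[symmetric] by (subst cdf_def2, subst measure_distr) simp_all
  also have "\<dots> = U.prob ?A + U.prob ?B"
    by (rule U.finite_measure_Union) (auto simp: sets_restrict_space_iff)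
  also have "U.prob ?A = min r (cdf \<mu> x)"
    using assms \<mu>.cdf_nonneg[of x] by (intro measure_unit_uniform_le) auto
  also have "U.prob ?B = U.prob ({u. u \<le> max r (cdf \<nu> x)} \<inter> {0<..<1}) - U.prob ({u. u \<le> r} \<inter> {0<..<1})"
    by (rule U.finite_measure_Diff) (auto simp: sets_restrict_space_iff)
  also have "\<dots> = max r (cdf \<nu> x) - r"
    using assms \<nu>.cdf_nonneg[of x] \<nu>.cdf_bounded_prob[of x]
    by (subst (1 2) measure_unit_uniform_le) auto
  finally show ?thesis by (auto simp: max_def)
qed

text \<open>\<open>xi_cdf\<close> is the distribution function of the splice and inherits
  monotonicity, right-continuity and limits from it. With these, \<open>interval_measure\<close>
  yields a probability law, determined by its distribution function.\<close>

lemma xi_dist_eq: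
  assumes q: "0 \<le> q" "q \<le> 1"
  shows "xi_dist \<mu> \<nu> q = distr unit_uniform borel (spliced_quantile \<mu> \<nu> (1 - q))"
proof -
  let ?D = "distr unit_uniform borel (spliced_quantile \<mu> \<nu> (1 - q))"
  interpret D: real_distribution ?D by simp
  have "xi_cdf \<mu> \<nu> q = cdf ?D"
    using q by (auto simp: fun_eq_iff xi_cdf_eq cdf_splice)
  then have eq: "xi_dist \<mu> \<nu> q = interval_measure (cdf ?D)"
    by (simp add: xi_dist_def)
  have *: "real_distribution (interval_measure (cdf ?D))"
    using D.cdf_nondecreasing D.cdf_is_right_cont D.cdf_lim_at_bot D.cdf_lim_at_top_prob
    by (intro real_distribution_interval_measure) auto
  have "cdf (interval_measure (cdf ?D)) = cdf ?D"
    using D.cdf_nondecreasing D.cdf_is_right_cont D.cdf_lim_at_bot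
    by (intro cdf_interval_measure) auto
  then show ?thesis
    using eq * D.real_distribution_axioms by (auto intro: cdf_unique)
qed

lemma integrable_quantile:
  "integrable unit_uniform (quantile \<mu>)" "integrable unit_uniform (quantile \<nu>)"
proof -
  show "integrable unit_uniform (quantile \<mu>)"
    using integrable_distr[OF \<mu>.measurable_quantile, of "\<lambda>x. x"] integrable_\<mu>
    unfolding \<mu>.distr_quantile by simp
  show "integrable unit_uniform (quantile \<nu>)"
    using integrable_distr[OF \<nu>.measurable_quantile, of "\<lambda>x. x"] integrable_\<nu>
    unfolding \<nu>.distr_quantile by simp
qed

lemma abs_splice_le: "\<bar>spliced_quantile \<mu> \<nu> r u\<bar> \<le> \<bar>quantile \<mu> u\<bar> + \<bar>quantile \<nu> u\<bar>"
  by (simp add: spliced_quantile_def)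

lemma integrable_splice: "integrable unit_uniform (spliced_quantile \<mu> \<nu> r)"
proof (rule Bochner_Integration.integrable_bound)
  show "integrable unit_uniform (\<lambda>u. \<bar>quantile \<mu> u\<bar> + \<bar>quantile \<nu> u\<bar>)"
    by (intro Bochner_Integration.integrable_add integrable_abs integrable_quantile)
  show "AE u in unit_uniform. norm (spliced_quantile \<mu> \<nu> r u)
          \<le> norm (\<bar>quantile \<mu> u\<bar> + \<bar>quantile \<nu> u\<bar>)"
    by (rule AE_I2) (simp add: spliced_quantile_def)
qed (rule measurable_splice)

text \<open>If \<open>r n\<close> tends to \<open>l\<close>, the splice at any
  \<open>u \<noteq> l\<close> is eventually constant in \<open>n\<close>, and both quantile
  functions together dominate it. Atoms of the two laws do no harm.\<close>

lemma continuous_mean_splice: "continuous_on UNIV (\<lambda>r. \<integral>u. spliced_quantile \<mu> \<nu> r u \<partial>unit_uniform)"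
  unfolding continuous_on_sequentially comp_def
proof (intro ballI allI impI, elim conjE)
  fix r :: "nat \<Rightarrow> real" and l assume r: "r \<longlonglongrightarrow> l"
  have "emeasure unit_uniform ({l} \<inter> {0<..<1}) = 0"
  proof -
    have "emeasure unit_uniform ({l} \<inter> {0<..<1}) = emeasure lborel ({l} \<inter> {0<..<1})"
      by (subst emeasure_restrict_space) auto
    also have "\<dots> \<le> emeasure lborel {l}" by (rule emeasure_mono) auto
    finally show ?thesis by simp
  qed
  then have "AE u in unit_uniform. u \<noteq> l"
    by (intro AE_I[where N="{l} \<inter> {0<..<1}"]) (auto simp: space_unit_uniform sets_restrict_space_iff)
  then have "AE u in unit_uniform. (\<lambda>n. spliced_quantile \<mu> \<nu> (r n) u) \<longlonglongrightarrow> spliced_quantile \<mu> \<nu> l u"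
  proof eventually_elim
    case (elim u)
    then consider "u < l" | "l < u" by linarith
    then show ?case
    proof cases
      case 1
      then have "eventually (\<lambda>n. u < r n) sequentially" by (rule order_tendstoD[OF r])
      then have "eventually (\<lambda>n. spliced_quantile \<mu> \<nu> (r n) u = spliced_quantile \<mu> \<nu> l u) sequentially"
        by eventually_elim (use 1 in \<open>auto simp: spliced_quantile_def\<close>)
      then show ?thesis by (rule tendsto_eventually)
    next
      case 2
      then have "eventually (\<lambda>n. r n < u) sequentially" by (rule order_tendstoD[OF r])
      then have "eventually (\<lambda>n. spliced_quantile \<mu> \<nu> (r n) u = spliced_quantile \<mu> \<nu> l u) sequentially"
        by eventually_elim (use 2 in \<open>auto simp: spliced_quantile_def\<close>)
      then show ?thesis by (rule tendsto_eventually)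
    qed
  qed
  note lim = this
  show "(\<lambda>n. \<integral>u. spliced_quantile \<mu> \<nu> (r n) u \<partial>unit_uniform)
          \<longlonglongrightarrow> (\<integral>u. spliced_quantile \<mu> \<nu> l u \<partial>unit_uniform)"
  proof (rule integral_dominated_convergence)
    show "integrable unit_uniform (\<lambda>u. \<bar>quantile \<mu> u\<bar> + \<bar>quantile \<nu> u\<bar>)"
      by (intro Bochner_Integration.integrable_add integrable_abs integrable_quantile)
    show "AE u in unit_uniform. norm (spliced_quantile \<mu> \<nu> (r n) u)
            \<le> \<bar>quantile \<mu> u\<bar> + \<bar>quantile \<nu> u\<bar>" for n
      by (rule AE_I2) (simp add: abs_splice_le)
  qed (rule measurable_splice lim)+
qed

lemma has_mean_xi_dist_iff:
  assumes "0 \<le> q" "q \<le> 1"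
  shows "has_bochner_integral (xi_dist \<mu> \<nu> q) (\<lambda>x. x) 0
           \<longleftrightarrow> (\<integral>u. spliced_quantile \<mu> \<nu> (1 - q) u \<partial>unit_uniform) = 0"
proof -
  have "integrable (xi_dist \<mu> \<nu> q) (\<lambda>x. x)"
    unfolding xi_dist_eq[OF assms]
    using integrable_splice[of "1 - q"]
    by (subst integrable_distr_eq[OF measurable_splice]) auto
  moreover have "(\<integral>x. x \<partial>xi_dist \<mu> \<nu> q) = (\<integral>u. spliced_quantile \<mu> \<nu> (1 - q) u \<partial>unit_uniform)"
    unfolding xi_dist_eq[OF assms] by (rule integral_distr[OF measurable_splice]) simp
  ultimately show ?thesis
    unfolding has_bochner_integral_iff by simp
qed

text \<open>The mean is that of \<mu> at q = 0 and that of \<nu> at q = 1, so the intermediate value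
  theorem gives a zero. By continuity the zeros in [0,1] form a compact set, which has a largest
  element; so \<open>GREATEST\<close> denotes an actual level.\<close>

lemma xi_level:
  "0 \<le> xi_level \<mu> \<nu>" "xi_level \<mu> \<nu> \<le> 1"
  "(\<integral>u. spliced_quantile \<mu> \<nu> (1 - xi_level \<mu> \<nu>) u \<partial>unit_uniform) = 0"
proof -
  define m where "m q = (\<integral>u. spliced_quantile \<mu> \<nu> (1 - q) u \<partial>unit_uniform)" for q
  have cont: "continuous_on A m" for A
    unfolding m_def
    by (rule continuous_on_compose2[OF continuous_mean_splice, where f="\<lambda>q. 1 - q"])
       (intro continuous_intros, simp)
  have "m 0 = (\<integral>u. quantile \<mu> u \<partial>unit_uniform)"
    unfolding m_def by (rule Bochner_Integration.integral_cong) (auto simp: spliced_quantile_def space_unit_uniform)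
  also have "\<dots> = (\<integral>x. x \<partial>\<mu>)"
    using integral_distr[OF \<mu>.measurable_quantile, of "\<lambda>x. x"]
    unfolding \<mu>.distr_quantile by simp
  finally have m0: "m 0 \<le> 0" using mean_\<mu> by simp
  have "m 1 = (\<integral>u. quantile \<nu> u \<partial>unit_uniform)"
    unfolding m_def by (rule Bochner_Integration.integral_cong) (auto simp: spliced_quantile_def space_unit_uniform)
  also have "\<dots> = (\<integral>x. x \<partial>\<nu>)"
    using integral_distr[OF \<nu>.measurable_quantile, of "\<lambda>x. x"]
    unfolding \<nu>.distr_quantile by simp
  finally have m1: "0 \<le> m 1" using mean_\<nu> by simp
  let ?Z = "{q \<in> {0..1}. m q = 0}"
  have "\<exists>q\<ge>0. q \<le> 1 \<and> m q = 0" by (rule IVT') (use m0 m1 cont in simp_all)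
  then have ne: "?Z \<noteq> {}" by auto
  have "closed ?Z"
    by (rule continuous_closed_preimage_constant) (auto intro: cont)
  moreover have "bounded ?Z" by (rule bounded_subset[of "{0..1}"]) auto
  ultimately have "compact ?Z" by (simp add: compact_eq_bounded_closed)
  from compact_attains_sup[OF this ne] obtain p where
    p: "p \<in> ?Z" "\<And>q. q \<in> ?Z \<Longrightarrow> q \<le> p" by auto
  let ?P = "\<lambda>q. 0 \<le> q \<and> q \<le> 1 \<and> has_bochner_integral (xi_dist \<mu> \<nu> q) (\<lambda>x. x) 0"
  have P: "?P q \<longleftrightarrow> q \<in> ?Z" for q
    using has_mean_xi_dist_iff[of q] by (auto simp: m_def)
  have "xi_level \<mu> \<nu> = p"
    unfolding xi_level_def by (rule Greatest_equality) (use p P in auto)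
  then show "0 \<le> xi_level \<mu> \<nu>" "xi_level \<mu> \<nu> \<le> 1"
    "(\<integral>u. spliced_quantile \<mu> \<nu> (1 - xi_level \<mu> \<nu>) u \<partial>unit_uniform) = 0"
    using p(1) by (auto simp: m_def)
qed

lemma xi_law_eq: "xi_law \<mu> \<nu> = distr unit_uniform borel (spliced_quantile \<mu> \<nu> (1 - xi_level \<mu> \<nu>))"
  unfolding xi_law_def using xi_level by (intro xi_dist_eq) auto

lemma integrable_xi_law: "integrable (xi_law \<mu> \<nu>) (\<lambda>x. x)"
  unfolding xi_law_eq using integrable_splice
  by (subst integrable_distr_eq[OF measurable_splice]) auto

text \<open>The integrated tail of the spliced law agrees with that of \<open>\<nu>\<close> above the splice and,
  by the zero mean, with that of \<open>\<mu>\<close> below it; in between it is affine, so that convexity of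
  \<open>f\<close> suffices.\<close>

lemma convex_le_xi_law:
  assumes conv: "convex_on UNIV f"
    and upper: "\<And>s. f s \<le> (\<integral>y. max (y - s) 0 \<partial>\<nu>)"
    and lower: "\<And>s. f s + s \<le> (\<integral>y. max (s - y) 0 \<partial>\<mu>)"
  shows "f s \<le> (\<integral>y. max (y - s) 0 \<partial>xi_law \<mu> \<nu>)"
proof -
  define r where "r = 1 - xi_level \<mu> \<nu>"
  have r: "0 \<le> r" "r \<le> 1" using xi_level by (auto simp: r_def)
  let ?V = "spliced_quantile \<mu> \<nu> r"
  define C where "C s = (\<integral>u. max (?V u - s) 0 \<partial>unit_uniform)" for s
  have C: "(\<integral>y. max (y - s) 0 \<partial>xi_law \<mu> \<nu>) = C s" for s
    unfolding xi_law_eq C_def r_def by (rule integral_distr[OF measurable_splice]) measurable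
  have int_V: "integrable unit_uniform ?V" by (rule integrable_splice)
  \<comment> \<open>The zero mean of the splice enters here, through
    \<open>max (s - v) 0 = max (v - s) 0 + (s - v)\<close>. It lets the bound by \<mu> be compared
    with the same function \<open>C\<close>.\<close>
  have C': "C s + s = (\<integral>u. max (s - ?V u) 0 \<partial>unit_uniform)" for s
  proof -
    have "(\<integral>u. max (s - ?V u) 0 \<partial>unit_uniform) = (\<integral>u. max (?V u - s) 0 + (s - ?V u) \<partial>unit_uniform)"
      by (rule Bochner_Integration.integral_cong) (auto simp: max_def)
    also have "\<dots> = C s + (s - (\<integral>u. ?V u \<partial>unit_uniform))"
      unfolding C_def using int_V U.prob_space by simp
    finally show ?thesis using xi_level(3) by (simp add: r_def)
  qed
  \<comment> \<open>For u \<le> r both the splice and the quantile of \<nu> are at most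
    \<open>s\<close>, so their positive parts vanish; for u > r the two variables coincide.\<close>
  have up: "f s \<le> C s" if "r \<le> 1" "\<And>u. 0 < u \<Longrightarrow> u < 1 \<Longrightarrow> u \<le> r \<Longrightarrow> quantile \<nu> u \<le> s" for s
  proof -
    have "f s \<le> (\<integral>y. max (y - s) 0 \<partial>distr unit_uniform borel (quantile \<nu>))"
      unfolding \<nu>.distr_quantile by (rule upper)
    also have "\<dots> = (\<integral>u. max (quantile \<nu> u - s) 0 \<partial>unit_uniform)"
      by (rule integral_distr[OF \<nu>.measurable_quantile]) measurable
    also have "\<dots> = C s"
      unfolding C_def
    proof (rule Bochner_Integration.integral_cong)
      fix u assume "u \<in> space unit_uniform"
      then have u: "0 < u" "u < 1" by (auto simp: space_unit_uniform)
      show "max (quantile \<nu> u - s) 0 = max (?V u - s) 0"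
        using that(2)[OF u] quantile_le_quantile[OF u] by (auto simp: spliced_quantile_def)
    qed simp
    finally show ?thesis .
  qed
  have low: "f s \<le> C s" if "\<And>u. 0 < u \<Longrightarrow> u < 1 \<Longrightarrow> r < u \<Longrightarrow> s \<le> quantile \<mu> u" for s
  proof -
    have "f s + s \<le> (\<integral>y. max (s - y) 0 \<partial>distr unit_uniform borel (quantile \<mu>))"
      unfolding \<mu>.distr_quantile by (rule lower)
    also have "\<dots> = (\<integral>u. max (s - quantile \<mu> u) 0 \<partial>unit_uniform)"
      by (rule integral_distr[OF \<mu>.measurable_quantile]) measurable
    also have "\<dots> = (\<integral>u. max (s - ?V u) 0 \<partial>unit_uniform)"
    proof (rule Bochner_Integration.integral_cong)
      fix u assume "u \<in> space unit_uniform"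
      then have u: "0 < u" "u < 1" by (auto simp: space_unit_uniform)
      show "max (s - quantile \<mu> u) 0 = max (s - ?V u) 0"
        using that[OF u] quantile_le_quantile[OF u] by (auto simp: spliced_quantile_def)
    qed simp
    also have "\<dots> = C s + s" using C' by simp
    finally show ?thesis by simp
  qed
  \<comment> \<open>The cases compare \<open>r\<close> with distribution functions instead of
    \<open>s\<close> with quantiles at \<open>r\<close>: those are sure to be meaningful only for 0
    < r < 1, which the third case forces.\<close>
  consider "r \<le> cdf \<nu> s" | "cdf \<mu> s \<le> r" | "cdf \<nu> s < r" "r < cdf \<mu> s" by linarith
  then have "f s \<le> C s"
  proof cases
    case 1
    then show ?thesis
      using r \<nu>.quantile_le_iff[of _ s] by (intro up) (auto intro: order_trans)
  next
    case 2
    have "s \<le> quantile \<mu> u" if "0 < u" "u < 1" "r < u" for u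
      using \<mu>.quantile_le_iff[of u s] that 2 by linarith
    then show ?thesis by (rule low)
  next
    case 3
    have r01: "0 < r" "r < 1"
      using 3 \<nu>.cdf_nonneg[of s] \<mu>.cdf_bounded_prob[of s] by linarith+
    define a b where "a = quantile \<mu> r" and "b = quantile \<nu> r"
    have as: "a \<le> s" using \<mu>.quantile_le_iff[OF r01, of s] 3 by (simp add: a_def)
    have sb: "s < b" using \<nu>.quantile_le_iff[OF r01, of s] 3 by (simp add: b_def)
    have fa: "f a \<le> C a"
      by (rule low) (auto simp: a_def intro!: \<mu>.quantile_mono r01)
    have fb: "f b \<le> C b"
      using r by (intro up) (auto simp: b_def intro!: \<nu>.quantile_mono r01)
    \<comment> \<open>The splice has no mass strictly between \<open>a\<close> and \<open>b\<close>.
      So \<open>C\<close> is affine on this interval, while \<open>f\<close> lies below its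
      chord.\<close>
    have V: "?V u \<le> a \<or> b \<le> ?V u" if "0 < u" "u < 1" for u
      using \<mu>.quantile_mono[of u r] \<nu>.quantile_mono[of r u] that r01
      by (auto simp: spliced_quantile_def a_def b_def)
    define l where "l = (s - a) / (b - a)"
    have l: "0 \<le> l" "l \<le> 1" using as sb by (auto simp: l_def field_simps)
    have s: "s = (1 - l) * a + l * b"
    proof -
      have "l * (b - a) = s - a" using as sb by (simp add: l_def)
      then show ?thesis by (simp add: algebra_simps)
    qed
    have "f s \<le> (1 - l) * f a + l * f b"
      using convex_onD[OF conv, of l a b] l s by simp
    also have "\<dots> \<le> (1 - l) * C a + l * C b"
      using fa fb l by (intro add_mono mult_left_mono) auto
    also have "\<dots> = (\<integral>u. (1 - l) * max (?V u - a) 0 + l * max (?V u - b) 0 \<partial>unit_uniform)"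
      unfolding C_def using int_V by (subst Bochner_Integration.integral_add) auto
    also have "\<dots> = C s"
      unfolding C_def
    proof (rule Bochner_Integration.integral_cong)
      fix u assume "u \<in> space unit_uniform"
      then have "?V u \<le> a \<or> b \<le> ?V u" by (intro V) (auto simp: space_unit_uniform)
      then show "(1 - l) * max (?V u - a) 0 + l * max (?V u - b) 0 = max (?V u - s) 0"
      proof
        assume "b \<le> ?V u"
        then show ?thesis using as sb s by (simp add: max_def algebra_simps)
      qed (use as sb in auto)
    qed simp
    finally show ?thesis .
  qed
  then show ?thesis using C by simp
qed

end

section \<open>Stop-loss transforms\<close>

lemma integrable_imp_set_integrable:
  fixes f :: "'a \<Rightarrow> real"
  shows "integrable M f \<Longrightarrow> A \<in> sets M \<Longrightarrow> set_integrable M A f"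
  unfolding set_integrable_def by (rule integrable_mult_indicator)

text \<open>On a set of infinite measure both sides are 0: \<open>measure\<close> defaults to 0, and
  the integral of a nonzero constant does too.\<close>

lemma set_integral_const:
  "A \<in> sets M \<Longrightarrow> (LINT x:A|M. (c::real)) = measure M A * c"
  by (cases "emeasure M A = \<infinity>")
     (simp_all add: set_lebesgue_integral_def  measure_def)

text \<open>Dynkin's argument: complements are handled by subtracting from the whole space, a member
  of \<open>G\<close>, and disjoint unions by countable additivity of the integral.\<close>

lemma set_integral_eq_on_sigma_sets:
  fixes f g :: "'a \<Rightarrow> real"
  assumes int: "integrable M f" "integrable M g"
    and G: "Int_stable G" "G \<subseteq> sets M" "space M \<in> G"
    and eq: "\<And>A. A \<in> G \<Longrightarrow> (LINT x:A|M. f x) = (LINT x:A|M. g x)"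
    and A: "A \<in> sigma_sets (space M) G"
  shows "(LINT x:A|M. f x) = (LINT x:A|M. g x)"
proof -
  have sub: "sigma_sets (space M) G \<subseteq> sets M"
    using G(2) by (rule sets.sigma_sets_subset)
  have "G \<subseteq> Pow (space M)" using G(2) sets.space_closed by blast
  from G(1) this A show ?thesis
  proof (induction rule: sigma_sets_induct_disjoint)
    case (compl A)
    have A: "A \<in> sets M" using compl sub by auto
    have *: "(LINT x:(space M - A)|M. h x) = (LINT x:space M|M. h x) - (LINT x:A|M. h x)"
      if h: "integrable M h" for h :: "'a \<Rightarrow> real"
    proof -
      have "(LINT x:(A \<union> (space M - A))|M. h x) = (LINT x:A|M. h x) + (LINT x:(space M - A)|M. h x)"
        using A h by (intro set_integral_Un integrable_imp_set_integrable) auto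
      moreover have "A \<union> (space M - A) = space M" using sets.sets_into_space[OF A] by auto
      ultimately show ?thesis by simp
    qed
    show ?case using *[OF int(1)] *[OF int(2)] eq[OF G(3)] compl by simp
  next
    case (union A)
    have A: "A i \<in> sets M" for i using union sub by auto
    have "(LINT x:(\<Union>i. A i)|M. h x) = (\<Sum>i. LINT x:A i|M. h x)"
      if "integrable M h" for h :: "'a \<Rightarrow> real"
      using union(1) A that
      by (intro lebesgue_integral_countable_add integrable_imp_set_integrable)
         (auto simp: disjoint_family_on_def)
    then show ?case using int union by simp
  qed (auto intro: eq simp: set_lebesgue_integral_def[of _ "{}"])
qed

text \<open>Conditional Jensen without conditional expectations: \<open>{s < d}\<close> is itself an event
  of \<open>G\<close>.\<close>

lemma set_integral_posp_le:
  fixes d \<delta> :: "'a \<Rightarrow> real"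
  assumes sub: "subalgebra M G" and "finite_measure M"
    and d: "d \<in> borel_measurable G" "integrable M d" and \<delta>: "integrable M \<delta>"
    and eq: "\<And>A. A \<in> sets G \<Longrightarrow> (LINT x:A|M. d x) = (LINT x:A|M. \<delta> x)"
    and B: "B \<in> sets G"
  shows "(LINT x:B|M. max (d x - s) 0) \<le> (LINT x:B|M. max (\<delta> x - s) 0)"
proof -
  interpret finite_measure M by fact
  let ?A = "B \<inter> {x \<in> space G. s < d x}"
  have A: "?A \<in> sets G" using d(1) B by measurable
  have sets: "A \<in> sets M" if "A \<in> sets G" for A using sub that by (auto simp: subalgebra_def)
  note [simp] = sets[OF A] sets[OF B]
  have "(LINT x:B|M. max (d x - s) 0) = (LINT x:?A|M. d x - s)"
    unfolding set_lebesgue_integral_def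
    using sub by (intro Bochner_Integration.integral_cong) (auto simp: indicator_def subalgebra_def max_def)
  also have "\<dots> = (LINT x:?A|M. d x) - (LINT x:?A|M. s)"
    using d by (intro set_integral_diff(2) integrable_imp_set_integrable) auto
  also have "\<dots> = (LINT x:?A|M. \<delta> x) - (LINT x:?A|M. s)"
    using eq[OF A] by simp
  also have "\<dots> = (LINT x:?A|M. \<delta> x - s)"
    using \<delta> by (intro set_integral_diff(2)[symmetric] integrable_imp_set_integrable) auto
  also have "\<dots> \<le> (LINT x:B|M. max (\<delta> x - s) 0)"
    unfolding set_lebesgue_integral_def
    using \<delta> by (intro integral_mono integrable_mult_indicator) (auto simp: indicator_def)
  finally show ?thesis .
qed

lemma set_integral_negp_le:
  fixes d \<delta> :: "'a \<Rightarrow> real"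
  assumes sub: "subalgebra M G" and "finite_measure M"
    and d: "d \<in> borel_measurable G" "integrable M d" and \<delta>: "integrable M \<delta>"
    and eq: "\<And>A. A \<in> sets G \<Longrightarrow> (LINT x:A|M. d x) = (LINT x:A|M. \<delta> x)"
    and B: "B \<in> sets G"
  shows "(LINT x:B|M. max (s - d x) 0) \<le> (LINT x:B|M. max (s - \<delta> x) 0)"
proof -
  have "(LINT x:A|M. - d x) = (LINT x:A|M. - \<delta> x)" if "A \<in> sets G" for A
    using eq[OF that] by (simp add: set_lebesgue_integral_def)
  from set_integral_posp_le[OF sub assms(2), of "\<lambda>x. - d x" "\<lambda>x. - \<delta> x", OF _ _ _ this B, of "- s"]
  show ?thesis using d \<delta> by simp
qed

section \<open>Integrated tails at random levels\<close>

text \<open>Supplies the integrability behind every exchange of integrals for sums of independent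
  variables below.\<close>

lemma integrable_pair_posp:
  fixes f :: "'a \<Rightarrow> real" and g :: "'b \<Rightarrow> real"
  assumes "prob_space A" "prob_space B" and f: "integrable A f" and g: "integrable B g"
  shows "integrable (A \<Otimes>\<^sub>M B) (\<lambda>(x, y). max (f x + g y - t) 0)"
proof -
  interpret A: prob_space A by fact
  interpret B: prob_space B by fact
  interpret pair_prob_space A B ..
  have [measurable]: "f \<in> borel_measurable A" "g \<in> borel_measurable B" using f g by auto
  have i1: "integrable (A \<Otimes>\<^sub>M B) (\<lambda>z. f (fst z))"
    by (rule integrable_distr[OF measurable_fst]) (simp add: B.distr_pair_fst f)
  have "integrable (B \<Otimes>\<^sub>M A) (\<lambda>z. g (fst z))"
    by (rule integrable_distr[OF measurable_fst]) (simp add: A.distr_pair_fst g)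
  then have i2: "integrable (A \<Otimes>\<^sub>M B) (\<lambda>z. g (snd z))"
    by (subst integrable_product_swap_iff[symmetric]) (simp add: case_prod_unfold)
  have "integrable (A \<Otimes>\<^sub>M B) (\<lambda>z. max (f (fst z) + g (snd z) - t) 0)"
    using i1 i2 by auto
  then show ?thesis by (simp add: case_prod_unfold)
qed

text \<open>This is the integrated tail: the integral of P(Y > u) over u > s. Comparing it at all
  levels \<open>s\<close> is the increasing convex order.\<close>

definition stop_loss :: "real measure \<Rightarrow> real \<Rightarrow> real" where
  "stop_loss L s = (\<integral>y. max (y - s) 0 \<partial>L)"

lemma stop_loss_nonneg: "0 \<le> stop_loss L s"
  by (simp add: stop_loss_def)

lemma abs_max_diff_le: "\<bar>max (x - s) 0 - max (x - t) 0\<bar> \<le> \<bar>s - t\<bar>" for x s t :: real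
  by (simp add: max_def abs_if)

text \<open>The positive part is 1-Lipschitz. This one bound yields continuity, measurability and
  linear growth in the passage to random levels.\<close>

lemma stop_loss_Lipschitz:
  assumes "prob_space L" "integrable L (\<lambda>x. x)"
  shows "\<bar>stop_loss L s - stop_loss L t\<bar> \<le> \<bar>s - t\<bar>"
proof -
  interpret prob_space L by fact
  have "stop_loss L s - stop_loss L t = (\<integral>y. max (y - s) 0 - max (y - t) 0 \<partial>L)"
    unfolding stop_loss_def using assms(2) by (intro Bochner_Integration.integral_diff[symmetric]) auto
  also have "\<bar>\<dots>\<bar> \<le> (\<integral>y. \<bar>max (y - s) 0 - max (y - t) 0\<bar> \<partial>L)"
    by (rule integral_abs_bound)
  also have "\<dots> \<le> (\<integral>y. \<bar>s - t\<bar> \<partial>L)"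
    using assms(2)
    by (intro integral_mono integrable_abs Bochner_Integration.integrable_diff integrable_max)
       (auto intro: abs_max_diff_le)
  finally show ?thesis by (simp add: prob_space)
qed

text \<open>Exchanging the integrals turns a random level for \<open>L\<close> into fixed levels for
  \<open>A\<close>, where a comparison of integrated tails of \<open>A\<close> can be
  applied.\<close>

lemma stop_loss_sum:
  assumes L: "prob_space L" "sets L = sets borel" "integrable L (\<lambda>x. x)"
    and "prob_space M" and A: "integrable M A"
  shows "(\<integral>\<omega>. stop_loss L (t - A \<omega>) \<partial>M) = (\<integral>y. (\<integral>\<omega>. max (A \<omega> - (t - y)) 0 \<partial>M) \<partial>L)"
proof -
  interpret L: prob_space L by fact
  interpret M: prob_space M by fact
  interpret pair_prob_space M L ..
  have "(\<integral>\<omega>. stop_loss L (t - A \<omega>) \<partial>M) = (\<integral>\<omega>. (\<integral>y. max (A \<omega> + y - t) 0 \<partial>L) \<partial>M)"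
    unfolding stop_loss_def by (simp add: algebra_simps)
  also have "\<dots> = (\<integral>y. (\<integral>\<omega>. max (A \<omega> + y - t) 0 \<partial>M) \<partial>L)"
    using integrable_pair_posp[OF assms(4,1) A L(3), of t] by (rule Fubini_integral[symmetric])
  finally show ?thesis by (simp add: algebra_simps)
qed

text \<open>If \<open>a\<close> is simple, each set \<open>{a = v}\<close> is an event of
  \<open>G\<close> on which the level is the constant \<open>v\<close>; the hypothesis applies to
  each piece and the pieces add up. The general case follows by dominated convergence on both
  sides.\<close>

lemma stop_loss_mixture:
  fixes a d :: "'a \<Rightarrow> real"
  assumes L: "prob_space L" "integrable L (\<lambda>x. x)"
    and "prob_space M" and sub: "subalgebra M G"
    and a: "a \<in> borel_measurable G" "integrable M a" and d: "integrable M d"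
    and le: "\<And>B s. B \<in> sets G \<Longrightarrow> (LINT x:B|M. max (d x - s) 0) \<le> measure M B * stop_loss L s"
  shows "(\<integral>x. max (d x - a x) 0 \<partial>M) \<le> (\<integral>x. stop_loss L (a x) \<partial>M)"
proof -
  interpret L: prob_space L by fact
  interpret M: prob_space M by fact
  have cont: "isCont (stop_loss L) s" for s
    unfolding continuous_at_eps_delta
  proof (intro allI impI)
    fix e :: real assume "0 < e"
    then show "\<exists>d>0. \<forall>y. dist y s < d \<longrightarrow> dist (stop_loss L y) (stop_loss L s) < e"
      using stop_loss_Lipschitz[OF L] by (auto simp: dist_real_def intro!: exI[of _ e] intro: le_less_trans)
  qed
  have bound: "\<bar>stop_loss L s\<bar> \<le> stop_loss L 0 + \<bar>s\<bar>" for s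
    using stop_loss_Lipschitz[OF L, of s 0] stop_loss_nonneg[of L 0] by linarith
  have [measurable]: "stop_loss L \<in> borel_measurable borel"
    using cont by (intro borel_measurable_continuous_onI) (simp add: continuous_at_imp_continuous_on)
  have spc: "space G = space M" and sets: "\<And>A. A \<in> sets G \<Longrightarrow> A \<in> sets M"
    using sub by (auto simp: subalgebra_def)
  have simple: "(\<integral>x. max (d x - p x) 0 \<partial>M) \<le> (\<integral>x. stop_loss L (p x) \<partial>M)"
    if p: "simple_function G p" for p
  proof -
    define B where "B v = p -` {v} \<inter> space M" for v
    define V where "V = p ` space M"
    have V: "finite V" using p spc by (auto simp: V_def simple_function_def)
    have B: "B v \<in> sets G" if "v \<in> V" for v
      using p that spc by (auto simp: B_def V_def simple_function_def)
    have p_meas: "p \<in> borel_measurable M"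
      using borel_measurable_simple_function[OF p] sub by (rule measurable_from_subalg[rotated])
    have split: "(\<integral>x. h x \<partial>M) = (\<Sum>v\<in>V. LINT x:B v|M. h x)" if h: "integrable M h" for h :: "'a \<Rightarrow> real"
    proof -
      have "(\<integral>x. h x \<partial>M) = (LINT x:(\<Union>v\<in>V. B v)|M. h x)"
      proof -
        have "(\<Union>v\<in>V. B v) = space M" by (auto simp: B_def V_def)
        then show ?thesis using set_integral_space[OF h] by simp
      qed
      also have "\<dots> = (\<Sum>v\<in>V. LINT x:B v|M. h x)"
        using V B h sets
        by (intro set_integral_finite_Union integrable_imp_set_integrable)
           (auto simp: disjoint_family_on_def B_def)
      finally show ?thesis .
    qed
    have "finite (p ` space M)" using V by (simp add: V_def)
    then have "bounded (p ` space M)" by (rule finite_imp_bounded)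
    then obtain K where K: "\<And>x. x \<in> space M \<Longrightarrow> \<bar>p x\<bar> \<le> K" by (auto simp: bounded_iff)
    have int_p: "integrable M p"
      by (rule M.integrable_const_bound[of _ K]) (use K p_meas in auto)
    have int_c: "integrable M (\<lambda>x. stop_loss L (p x))"
      using p_meas by (intro M.integrable_const_bound[of _ "stop_loss L 0 + K"] AE_I2)
         (auto intro!: order_trans[OF bound] K)
    have "(\<integral>x. max (d x - p x) 0 \<partial>M) = (\<Sum>v\<in>V. LINT x:B v|M. max (d x - p x) 0)"
      using d int_p by (intro split) auto
    also have "\<dots> = (\<Sum>v\<in>V. LINT x:B v|M. max (d x - v) 0)"
      using B sets by (intro sum.cong set_lebesgue_integral_cong) (auto simp: B_def)
    also have "\<dots> \<le> (\<Sum>v\<in>V. measure M (B v) * stop_loss L v)"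
      by (intro sum_mono le B)
    also have "\<dots> = (\<Sum>v\<in>V. LINT x:B v|M. stop_loss L v)"
      using B sets by (intro sum.cong refl set_integral_const[symmetric]) auto
    also have "\<dots> = (\<Sum>v\<in>V. LINT x:B v|M. stop_loss L (p x))"
      using B sets by (intro sum.cong set_lebesgue_integral_cong) (auto simp: B_def)
    also have "\<dots> = (\<integral>x. stop_loss L (p x) \<partial>M)"
      using int_c by (rule split[symmetric])
    finally show ?thesis .
  qed
  \<comment> \<open>Approximation relative to the base point 0 comes with the factor 2, which gives
    an integrable bound uniform in \<open>i\<close>.\<close>
  obtain p where p: "\<And>i. simple_function G (p i)"
    and lim: "\<And>x. x \<in> space M \<Longrightarrow> (\<lambda>i. p i x) \<longlonglongrightarrow> a x"
    and bd: "\<And>i x. x \<in> space M \<Longrightarrow> \<bar>p i x\<bar> \<le> 2 * \<bar>a x\<bar>"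
    using borel_measurable_implies_sequence_metric[OF a(1), of 0] spc
    by (simp add: dist_real_def) metis
  have p_meas [measurable]: "p i \<in> borel_measurable M" for i
    using borel_measurable_simple_function[OF p] sub by (rule measurable_from_subalg[rotated])
  have [measurable]: "a \<in> borel_measurable M" "d \<in> borel_measurable M" using a d by auto
  have "(\<lambda>i. \<integral>x. max (d x - p i x) 0 \<partial>M) \<longlonglongrightarrow> (\<integral>x. max (d x - a x) 0 \<partial>M)"
  proof (rule integral_dominated_convergence)
    show "integrable M (\<lambda>x. \<bar>d x\<bar> + 2 * \<bar>a x\<bar>)" using a d by auto
    show "AE x in M. (\<lambda>i. max (d x - p i x) 0) \<longlonglongrightarrow> max (d x - a x) 0"
      by (intro AE_I2 tendsto_intros lim)
    show "AE x in M. norm (max (d x - p i x) 0) \<le> \<bar>d x\<bar> + 2 * \<bar>a x\<bar>" for i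
    proof (rule AE_I2)
      fix x assume "x \<in> space M"
      from bd[OF this, of i] show "norm (max (d x - p i x) 0) \<le> \<bar>d x\<bar> + 2 * \<bar>a x\<bar>"
        by (simp add: max_def) linarith
    qed
  qed measurable
  moreover have "(\<lambda>i. \<integral>x. stop_loss L (p i x) \<partial>M) \<longlonglongrightarrow> (\<integral>x. stop_loss L (a x) \<partial>M)"
  proof (rule integral_dominated_convergence)
    show "integrable M (\<lambda>x. stop_loss L 0 + 2 * \<bar>a x\<bar>)" using a by auto
    show "AE x in M. (\<lambda>i. stop_loss L (p i x)) \<longlonglongrightarrow> stop_loss L (a x)"
      by (intro AE_I2 isCont_tendsto_compose[OF cont] lim)
    show "AE x in M. norm (stop_loss L (p i x)) \<le> stop_loss L 0 + 2 * \<bar>a x\<bar>" for i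
    proof (rule AE_I2)
      fix x assume "x \<in> space M"
      from bd[OF this, of i] bound[of "p i x"]
      show "norm (stop_loss L (p i x)) \<le> stop_loss L 0 + 2 * \<bar>a x\<bar>" by simp
    qed
  qed measurable
  ultimately show ?thesis
    by (rule LIMSEQ_le) (use simple[OF p] in auto)
qed

section \<open>Resampling one coordinate\<close>

lemma space_generated_sigma [simp]: "space (generated_sigma M S X J) = space M"
  by (auto simp: generated_sigma_def intro!: space_measure_of)

lemma sets_generated_sigma:
  "sets (generated_sigma M S X J)
     = sigma_sets (space M) (\<Union>j\<in>J. {X j -` A \<inter> space M | A. A \<in> sets S})"
  unfolding generated_sigma_def by (intro sets_measure_of) auto

lemma sets_generated_sigma_mono:
  "J \<subseteq> K \<Longrightarrow> sets (generated_sigma M S X J) \<subseteq> sets (generated_sigma M S X K)"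
  unfolding sets_generated_sigma by (intro sigma_sets_mono') auto

lemma vimage_in_generated_sigma:
  "j \<in> J \<Longrightarrow> A \<in> sets S \<Longrightarrow> X j -` A \<inter> space M \<in> sets (generated_sigma M S X J)"
  unfolding sets_generated_sigma by (rule sigma_sets.Basic) auto

lemma measurable_generated_sigma:
  assumes "j \<in> J" "X j \<in> measurable M S"
  shows "X j \<in> measurable (generated_sigma M S X J) S"
  using assms measurable_space[OF assms(2)] vimage_in_generated_sigma[OF assms(1)]
  by (intro measurableI) auto

lemma measurable_restrict_generated_sigma:
  assumes "\<And>j. j \<in> J \<Longrightarrow> X j \<in> measurable M S"
  shows "(\<lambda>\<omega>. \<lambda>j\<in>J. X j \<omega>) \<in> measurable (generated_sigma M S X J) (PiM J (\<lambda>_. S))"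
  using assms by (intro measurable_restrict measurable_generated_sigma)

lemma subalgebra_generated_sigma:
  assumes "\<And>j. j \<in> J \<Longrightarrow> X j \<in> measurable M S"
  shows "subalgebra M (generated_sigma M S X J)"
  unfolding subalgebra_def sets_generated_sigma
  using assms by (auto intro!: sets.sigma_sets_subset)

text \<open>The preimages under the tuple map form a sigma-field containing all generators. Thus an
  event of the past is a condition on the past coordinates alone.\<close>

lemma generated_sigma_vimageE:
  assumes X: "\<And>j. j \<in> J \<Longrightarrow> X j \<in> measurable M S"
    and B: "B \<in> sets (generated_sigma M S X J)"
  obtains B' where "B' \<in> sets (PiM J (\<lambda>_. S))" "B = (\<lambda>\<omega>. \<lambda>j\<in>J. X j \<omega>) -` B' \<inter> space M"
proof -
  let ?t = "\<lambda>\<omega>. \<lambda>j\<in>J. X j \<omega>"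
  let ?V = "vimage_algebra (space M) ?t (PiM J (\<lambda>_. S))"
  have t: "?t \<in> space M \<rightarrow> space (PiM J (\<lambda>_. S))"
    using measurable_space[OF X] by (auto simp: space_PiM)
  have "X j -` A \<inter> space M \<in> sets ?V" if "j \<in> J" "A \<in> sets S" for j A
  proof -
    have "(\<lambda>\<omega>. ?t \<omega> j) \<in> measurable ?V S"
      using measurable_vimage_algebra1[OF t] measurable_component_singleton[OF that(1)]
      by (rule measurable_compose)
    from measurable_sets[OF this that(2)] show ?thesis using that(1) by simp
  qed
  then have "sigma_sets (space M) (\<Union>j\<in>J. {X j -` A \<inter> space M | A. A \<in> sets S}) \<subseteq> sets ?V"
    using sets.sigma_sets_subset[of "\<Union>j\<in>J. {X j -` A \<inter> space M | A. A \<in> sets S}" ?V]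
    unfolding space_vimage_algebra by blast
  then have "B \<in> sets ?V" using B unfolding sets_generated_sigma by auto
  then show ?thesis using that unfolding sets_vimage_algebra2[OF t] by auto
qed

declare One_nat_def [simp del]

section \<open>Independence structure of the resampled family\<close>

locale resampling = prob_space M for M :: "'a measure" +
  fixes S :: "'x measure" and n :: nat and X X' :: "nat \<Rightarrow> 'a \<Rightarrow> 'x"
    and F :: "(nat \<Rightarrow> 'x) \<Rightarrow> real"
  assumes indep: "indep_vars (\<lambda>_. S) X {1..n}"
    and F [measurable]: "F \<in> borel_measurable (PiM {1..n} (\<lambda>_. S))"
    and integrable_F: "integrable M (\<lambda>\<omega>. F (\<lambda>j\<in>{1..n}. X j \<omega>))"
    and X': "\<And>i. i \<in> {1..n} \<Longrightarrow> X' i \<in> measurable M S"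
    and distr_X': "\<And>i. i \<in> {1..n} \<Longrightarrow> distr M S (X' i) = distr M S (X i)"
    and indep_X': "\<And>i. i \<in> {1..n} \<Longrightarrow> indep_set {X' i -` A \<inter> space M | A. A \<in> sets S}
             (sets (generated_sigma M S X {1..n}))"
begin

definition Z where "Z \<omega> = F (\<lambda>j\<in>{1..n}. X j \<omega>)"

definition Zr where "Zr i \<omega> = F ((\<lambda>j\<in>{1..n}. X j \<omega>)(i := X' i \<omega>))"

abbreviation "\<F> k \<equiv> generated_sigma M S X {1..k}"

lemma X: "j \<in> {1..n} \<Longrightarrow> X j \<in> measurable M S"
  using indep by (auto simp: indep_vars_def2)

lemma integrable_Z: "integrable M Z"
  unfolding Z_def[abs_def] by (rule integrable_F)

lemma subalgebra_\<F>: "k \<le> n \<Longrightarrow> subalgebra M (\<F> k)"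
  by (rule subalgebra_generated_sigma) (auto intro: X)

lemma sigma_finite_\<F>: "k \<le> n \<Longrightarrow> sigma_finite_subalgebra M (\<F> k)"
  by (intro finite_measure_subalgebra_is_sigma_finite finite_measure_subalgebra.intro
      finite_measure_subalgebra_axioms.intro subalgebra_\<F> finite_measure_axioms)

lemma sets_\<F>_mono: "j \<le> k \<Longrightarrow> sets (\<F> j) \<subseteq> sets (\<F> k)"
  by (rule sets_generated_sigma_mono) auto

text \<open>The family \<open>X\<close> extended by the resampled variable, placed at the free index \<open>0\<close>.\<close>

definition ext where "ext k j = (if j = 0 then X' k else X j)"

text \<open>For a finite \<open>J\<close> containing 0, the intersection over the other indices is
  an event of \<open>\<F> n\<close>, from which \<open>X' k\<close> is independent. Splitting off
  index 0 leaves a product over the \<open>X j\<close>.\<close>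

lemma indep_ext:
  assumes k: "k \<in> {1..n}"
  shows "indep_vars (\<lambda>_. S) (ext k) {0..n}"
  unfolding indep_vars_def2
proof (intro conjI ballI indep_setsI)
  show rv: "ext k j \<in> measurable M S" if "j \<in> {0..n}" for j
    using that X X' k by (cases "j = 0") (auto simp: ext_def)
  show "{ext k j -` A \<inter> space M | A. A \<in> sets S} \<subseteq> events" if "j \<in> {0..n}" for j
    using rv[OF that] by auto
next
  fix A :: "nat \<Rightarrow> 'a set" and J
  assume J: "J \<noteq> {}" "J \<subseteq> {0..n}" "finite J"
    and A: "\<forall>j\<in>J. A j \<in> {ext k j -` A \<inter> space M | A. A \<in> sets S}"
  let ?J = "J - {0}"
  have A_X: "A j \<in> {X j -` A \<inter> space M | A. A \<in> sets S}" if "j \<in> ?J" for j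
    using A that unfolding ext_def by force
  have *: "?J = {} \<or> prob (\<Inter>j\<in>?J. A j) = (\<Prod>j\<in>?J. prob (A j))"
  proof (cases "?J = {}")
    case False
    have "?J \<subseteq> {1..n}" using J by auto
    moreover have "indep_sets (\<lambda>i. {X i -` A \<inter> space M | A. A \<in> sets S}) {1..n}"
      using indep by (simp add: indep_vars_def2)
    ultimately show ?thesis
      using False A_X J(3) by (intro disjI2 indep_setsD) auto
  qed simp
  show "prob (\<Inter>j\<in>J. A j) = (\<Prod>j\<in>J. prob (A j))"
  proof (cases "0 \<in> J")
    case False
    then show ?thesis using * J by simp
  next
    case True
    then have "A 0 \<in> {ext k 0 -` A \<inter> space M | A. A \<in> sets S}"
      using A by blast
    then have A0: "A 0 \<in> {X' k -` A \<inter> space M | A. A \<in> sets S}"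
      by (simp add: ext_def)
    show ?thesis
    \<comment> \<open>An empty intersection is \<open>UNIV\<close>, which need not be an event, so
      \<open>J = {0}\<close> is treated apart.\<close>
    proof (cases "?J = {}")
      case True
      then have "J = {0}" using J by auto
      then show ?thesis by simp
    next
      case False
      have "(\<Inter>j\<in>?J. A j) \<in> sets (\<F> n)"
      proof (rule sets.finite_INT[OF _ False])
        show "A j \<in> sets (\<F> n)" if "j \<in> ?J" for j
          using A_X[OF that] that J vimage_in_generated_sigma[of j "{1..n}" _ S X M] by auto
      qed (use J in auto)
      with A0 have "prob (A 0 \<inter> (\<Inter>j\<in>?J. A j)) = prob (A 0) * prob (\<Inter>j\<in>?J. A j)"
        using indep_setD[OF indep_X'[OF k]] by blast
      moreover have "(\<Inter>j\<in>J. A j) = A 0 \<inter> (\<Inter>j\<in>?J. A j)" using True by auto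
      moreover have "(\<Prod>j\<in>J. prob (A j)) = prob (A 0) * (\<Prod>j\<in>?J. prob (A j))"
        using True J by (intro prod.remove) auto
      ultimately show ?thesis using * False by simp
    qed
  qed
qed

text \<open>The swapped family is a relabelled subfamily of \<open>ext k\<close>: position
  \<open>k\<close> reads index 0. The map \<open>?\<sigma>\<close> performs this relabelling, and
  \<open>?\<tau>\<close> undoes it on \<open>J\<close>.\<close>

lemma indep_swap:
  assumes k: "k \<in> {1..n}"
  shows "indep_vars (\<lambda>_. S) (X(k := X' k)) {1..n}"
proof -
  let ?\<sigma> = "\<lambda>j. if j = k then 0 else j"
  have *: "indep_sets (\<lambda>i. {ext k i -` A \<inter> space M | A. A \<in> sets S}) {0..n}"
    and rv: "\<And>i. i \<in> {0..n} \<Longrightarrow> ext k i \<in> measurable M S"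
    using indep_ext[OF k] by (auto simp: indep_vars_def2)
  have eq: "(X(k := X' k)) j = ext k (?\<sigma> j)" if "j \<in> {1..n}" for j
    using that by (auto simp: ext_def)
  show ?thesis
    unfolding indep_vars_def2
  proof (intro conjI ballI indep_setsI)
    show rv': "(X(k := X' k)) j \<in> measurable M S" if "j \<in> {1..n}" for j
      using rv[of "?\<sigma> j"] that unfolding eq[OF that] by auto
    show "{(X(k := X' k)) j -` A \<inter> space M | A. A \<in> sets S} \<subseteq> events" if "j \<in> {1..n}" for j
      using rv'[OF that] by (auto simp del: fun_upd_apply)
  next
    fix A :: "nat \<Rightarrow> 'a set" and J
    assume J: "J \<noteq> {}" "J \<subseteq> {1..n}" "finite J"
      and A: "\<forall>j\<in>J. A j \<in> {(X(k := X' k)) j -` A \<inter> space M | A. A \<in> sets S}"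
    let ?\<tau> = "\<lambda>j. if j = 0 then k else j"
    have inj: "inj_on ?\<sigma> J" using J by (auto simp: inj_on_def)
    have \<tau>: "?\<tau> (?\<sigma> j) = j" if "j \<in> J" for j using that J k by auto
    have "prob (\<Inter>i\<in>?\<sigma> ` J. A (?\<tau> i)) = (\<Prod>i\<in>?\<sigma> ` J. prob (A (?\<tau> i)))"
    proof (rule indep_setsD[OF *])
      show "\<forall>i\<in>?\<sigma> ` J. A (?\<tau> i) \<in> {ext k i -` A \<inter> space M | A. A \<in> sets S}"
      proof
        fix i assume "i \<in> ?\<sigma> ` J"
        then obtain j where j: "j \<in> J" "i = ?\<sigma> j" by auto
        then have "A (?\<tau> i) = A j" using \<tau>[OF j(1)] by (simp only:)
        moreover have "A j \<in> {(X(k := X' k)) j -` A \<inter> space M | A. A \<in> sets S}"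
          using A j(1) by blast
        moreover have "(X(k := X' k)) j = ext k i" using eq[of j] j J by blast
        ultimately show "A (?\<tau> i) \<in> {ext k i -` A \<inter> space M | A. A \<in> sets S}"
          by (simp only:)
      qed
    qed (use J in auto)
    also have "(\<Inter>i\<in>?\<sigma> ` J. A (?\<tau> i)) = (\<Inter>j\<in>J. A j)"
      unfolding image_image by (intro INF_cong refl arg_cong[where f=A] \<tau>)
    also have "(\<Prod>i\<in>?\<sigma> ` J. prob (A (?\<tau> i))) = (\<Prod>j\<in>J. prob (A j))"
      using \<tau> by (subst prod.reindex[OF inj]) (auto intro!: prod.cong)
    finally show "prob (\<Inter>j\<in>J. A j) = (\<Prod>j\<in>J. prob (A j))" .
  qed
qed

text \<open>Both tuples are independent families, so their laws are products of marginals, and the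
  only marginal that is replaced stays the same.\<close>

lemma distr_swap:
  assumes k: "k \<in> {1..n}"
  shows "distr M (PiM {1..n} (\<lambda>_. S)) (\<lambda>\<omega>. (\<lambda>j\<in>{1..n}. X j \<omega>)(k := X' k \<omega>))
       = distr M (PiM {1..n} (\<lambda>_. S)) (\<lambda>\<omega>. \<lambda>j\<in>{1..n}. X j \<omega>)"
proof -
  have ne: "{1..n} \<noteq> {}" using k by auto
  have upd: "(\<lambda>\<omega>. (\<lambda>j\<in>{1..n}. X j \<omega>)(k := X' k \<omega>)) = (\<lambda>\<omega>. \<lambda>j\<in>{1..n}. (X(k := X' k)) j \<omega>)"
    using k by (auto simp: fun_eq_iff)
  have rv: "j \<in> {1..n} \<Longrightarrow> (X(k := X' k)) j \<in> measurable M S" for j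
    using X X'[OF k] by auto
  have "distr M (PiM {1..n} (\<lambda>_. S)) (\<lambda>\<omega>. \<lambda>j\<in>{1..n}. (X(k := X' k)) j \<omega>)
      = (\<Pi>\<^sub>M j\<in>{1..n}. distr M S ((X(k := X' k)) j))"
    using indep_swap[OF k] indep_vars_iff_distr_eq_PiM'[where X="X(k := X' k)" and M'="\<lambda>_. S", OF ne rv] by blast
  also have "\<dots> = (\<Pi>\<^sub>M j\<in>{1..n}. distr M S (X j))"
    using distr_X' by (intro PiM_cong) auto
  also have "\<dots> = distr M (PiM {1..n} (\<lambda>_. S)) (\<lambda>\<omega>. \<lambda>j\<in>{1..n}. X j \<omega>)"
    using indep indep_vars_iff_distr_eq_PiM'[where X=X and M'="\<lambda>_. S", OF ne X] by simp
  finally show ?thesis unfolding upd .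
qed

lemma measurable_tuple [measurable]:
  "(\<lambda>\<omega>. \<lambda>j\<in>{1..n}. X j \<omega>) \<in> measurable M (PiM {1..n} (\<lambda>_. S))"
  by (intro measurable_restrict X)

lemma measurable_tuple_upd:
  assumes "k \<in> {1..n}"
  shows "(\<lambda>\<omega>. (\<lambda>j\<in>{1..n}. X j \<omega>)(k := X' k \<omega>)) \<in> measurable M (PiM {1..n} (\<lambda>_. S))"
proof -
  have "(\<lambda>\<omega>. (\<lambda>j\<in>{1..n}. X j \<omega>)(k := X' k \<omega>)) = (\<lambda>\<omega>. \<lambda>j\<in>{1..n}. (X(k := X' k)) j \<omega>)"
    using assms by (auto simp: fun_eq_iff)
  moreover have "(\<lambda>\<omega>. \<lambda>j\<in>{1..n}. (X(k := X' k)) j \<omega>) \<in> measurable M (PiM {1..n} (\<lambda>_. S))"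
    using X X'[OF assms] by (intro measurable_restrict) auto
  ultimately show ?thesis by simp
qed

lemma integrable_Zr:
  assumes k: "k \<in> {1..n}" shows "integrable M (Zr k)"
proof -
  have "integrable (distr M (PiM {1..n} (\<lambda>_. S)) (\<lambda>\<omega>. \<lambda>j\<in>{1..n}. X j \<omega>)) F"
    using integrable_F F by (subst integrable_distr_eq[OF measurable_tuple])
  then show ?thesis
    unfolding distr_swap[OF k, symmetric] Zr_def[abs_def]
    by (rule integrable_distr[OF measurable_tuple_upd[OF k]])
qed

lemma past_restrict:
  assumes k: "k \<in> {1..n}" and B: "B \<in> sets (\<F> (k - 1))"
  obtains B' where "B' \<in> sets (PiM {1..k-1} (\<lambda>_. S))"
    "\<And>\<omega>. \<omega> \<in> space M \<Longrightarrow> \<omega> \<in> B \<longleftrightarrow> (\<lambda>j\<in>{1..k-1}. X j \<omega>) \<in> B'"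
proof -
  have "j \<in> {1..k-1} \<Longrightarrow> X j \<in> measurable M S" for j using X k by auto
  from generated_sigma_vimageE[OF this B] obtain B' where
    "B' \<in> sets (PiM {1..k-1} (\<lambda>_. S))" "B = (\<lambda>\<omega>. \<lambda>j\<in>{1..k-1}. X j \<omega>) -` B' \<inter> space M" .
  then show ?thesis using that by auto
qed

text \<open>Membership in \<open>B\<close> depends on coordinates before \<open>k\<close> only,
  which the swap leaves untouched. The indicator can therefore be absorbed into a function
  \<open>G\<close> of the tuple, and equality of the laws finishes.\<close>

lemma set_integral_Zr_past:
  assumes k: "k \<in> {1..n}" and B: "B \<in> sets (\<F> (k - 1))"
  shows "(LINT \<omega>:B|M. Zr k \<omega>) = (LINT \<omega>:B|M. Z \<omega>)"
proof -
  obtain B' where B' [measurable]: "B' \<in> sets (PiM {1..k-1} (\<lambda>_. S))"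
    and iff: "\<And>\<omega>. \<omega> \<in> space M \<Longrightarrow> \<omega> \<in> B \<longleftrightarrow> (\<lambda>j\<in>{1..k-1}. X j \<omega>) \<in> B'"
    using past_restrict[OF k B] by blast
  define G where "G x = indicator B' (restrict x {1..k-1}) * F x" for x
  have sub: "{1..k-1} \<subseteq> {1..n}" using k by auto
  have [measurable]: "(\<lambda>x. restrict x {1..k-1}) \<in> measurable (PiM {1..n} (\<lambda>_. S)) (PiM {1..k-1} (\<lambda>_. S))"
    by (rule measurable_restrict_subset[OF sub])
  have G [measurable]: "G \<in> borel_measurable (PiM {1..n} (\<lambda>_. S))"
    unfolding G_def by measurable
  have "(LINT \<omega>:B|M. Zr k \<omega>) = (\<integral>\<omega>. G ((\<lambda>j\<in>{1..n}. X j \<omega>)(k := X' k \<omega>)) \<partial>M)"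
    unfolding set_lebesgue_integral_def
  proof (rule Bochner_Integration.integral_cong)
    fix \<omega> assume "\<omega> \<in> space M"
    moreover have "restrict ((\<lambda>j\<in>{1..n}. X j \<omega>)(k := X' k \<omega>)) {1..k-1} = (\<lambda>j\<in>{1..k-1}. X j \<omega>)"
      using k by (auto simp: fun_eq_iff)
    ultimately show "indicator B \<omega> *\<^sub>R Zr k \<omega> = G ((\<lambda>j\<in>{1..n}. X j \<omega>)(k := X' k \<omega>))"
      using iff by (simp add: G_def Zr_def indicator_def)
  qed simp
  also have "\<dots> = (\<integral>x. G x \<partial>distr M (PiM {1..n} (\<lambda>_. S)) (\<lambda>\<omega>. (\<lambda>j\<in>{1..n}. X j \<omega>)(k := X' k \<omega>)))"
    by (rule integral_distr[OF measurable_tuple_upd[OF k] G, symmetric])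
  also have "\<dots> = (\<integral>\<omega>. G (\<lambda>j\<in>{1..n}. X j \<omega>) \<partial>M)"
    unfolding distr_swap[OF k] by (rule integral_distr[OF measurable_tuple G])
  also have "\<dots> = (LINT \<omega>:B|M. Z \<omega>)"
    unfolding set_lebesgue_integral_def
  proof (rule Bochner_Integration.integral_cong)
    fix \<omega> assume "\<omega> \<in> space M"
    moreover have "restrict (\<lambda>j\<in>{1..n}. X j \<omega>) {1..k-1} = (\<lambda>j\<in>{1..k-1}. X j \<omega>)"
      using k by (auto simp: fun_eq_iff)
    ultimately show "G (\<lambda>j\<in>{1..n}. X j \<omega>) = indicator B \<omega> *\<^sub>R Z \<omega>"
      using iff by (simp add: G_def Z_def indicator_def)
  qed simp
  finally show ?thesis .
qed

text \<open>Index 0, that is \<open>X' k\<close>, lies in the second block. This separates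
  \<open>X k\<close> from the past and from everything that \<open>Zr k\<close> depends on.\<close>

lemma indep_present_rest:
  assumes k: "k \<in> {1..n}"
  shows "indep_set (sets (generated_sigma M S X {k}))
           (sets (generated_sigma M S (ext k) ({0..n} - {k})))"
proof -
  let ?E = "\<lambda>i. {ext k i -` A \<inter> space M | A. A \<in> sets S}"
  let ?I = "case_bool {k} ({0..n} - {k})"
  have "indep_sets ?E (\<Union>b\<in>UNIV. ?I b)"
  proof -
    have "(\<Union>b\<in>UNIV. ?I b) = {0..n}" using k by (auto simp: UNIV_bool)
    then show ?thesis using indep_ext[OF k] by (simp add: indep_vars_def2)
  qed
  \<comment> \<open>Stability under intersection lets independence pass from generators to the
    sigma-fields of the two blocks.\<close>
  moreover have "Int_stable (?E i)" for i
  proof (rule Int_stableI)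
    fix a b assume "a \<in> ?E i" "b \<in> ?E i"
    then obtain A B where "A \<in> sets S" "a = ext k i -` A \<inter> space M"
      "B \<in> sets S" "b = ext k i -` B \<inter> space M" by auto
    then show "a \<inter> b \<in> ?E i" by (intro CollectI exI[of _ "A \<inter> B"]) auto
  qed
  moreover have "disjoint_family_on ?I UNIV"
    by (auto simp: disjoint_family_on_def split: bool.split)
  ultimately have "indep_sets (\<lambda>b. sigma_sets (space M) (\<Union>i\<in>?I b. ?E i)) UNIV"
    by (rule indep_sets_collect_sigma)
  moreover have "(\<lambda>b. sigma_sets (space M) (\<Union>i\<in>?I b. ?E i))
      = case_bool (sets (generated_sigma M S X {k})) (sets (generated_sigma M S (ext k) ({0..n} - {k})))"
    using k by (auto simp: fun_eq_iff sets_generated_sigma ext_def split: bool.split)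
  ultimately show ?thesis unfolding indep_set_def by simp
qed

lemma subalgebra_rest:
  assumes k: "k \<in> {1..n}"
  shows "subalgebra M (generated_sigma M S (ext k) ({0..n} - {k}))"
    and "subalgebra (generated_sigma M S (ext k) ({0..n} - {k})) (\<F> (k - 1))"
proof -
  show "subalgebra M (generated_sigma M S (ext k) ({0..n} - {k}))"
    using indep_ext[OF k] by (intro subalgebra_generated_sigma) (auto simp: indep_vars_def2)
  have "\<F> (k - 1) = generated_sigma M S (ext k) {1..k-1}"
    unfolding generated_sigma_def by (intro arg_cong[where f="sigma (space M)"] SUP_cong) (auto simp: ext_def)
  moreover have "{1..k-1} \<subseteq> {0..n} - {k}" using k by auto
  ultimately show "subalgebra (generated_sigma M S (ext k) ({0..n} - {k})) (\<F> (k - 1))"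
    unfolding subalgebra_def by (simp add: sets_generated_sigma_mono)
qed

lemma measurable_Zr_rest:
  assumes k: "k \<in> {1..n}"
  shows "Zr k \<in> borel_measurable (generated_sigma M S (ext k) ({0..n} - {k}))"
proof -
  let ?G = "generated_sigma M S (ext k) ({0..n} - {k})"
  let ?\<sigma> = "\<lambda>j. if j = k then 0 else j"
  have "(\<lambda>\<omega>. (\<lambda>j\<in>{1..n}. X j \<omega>)(k := X' k \<omega>)) = (\<lambda>\<omega>. \<lambda>j\<in>{1..n}. ext k (?\<sigma> j) \<omega>)"
    using k by (auto simp: fun_eq_iff ext_def)
  moreover have "(\<lambda>\<omega>. \<lambda>j\<in>{1..n}. ext k (?\<sigma> j) \<omega>) \<in> measurable ?G (PiM {1..n} (\<lambda>_. S))"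
  proof (rule measurable_restrict)
    fix j assume j: "j \<in> {1..n}"
    show "ext k (?\<sigma> j) \<in> measurable ?G S"
      using indep_ext[OF k] j k by (intro measurable_generated_sigma) (auto simp: indep_vars_def2)
  qed
  ultimately show ?thesis
    unfolding Zr_def[abs_def] by (intro measurable_compose[OF _ F]) simp
qed

end

section \<open>Factorisation over events and the martingale differences\<close>

lemma (in prob_space) set_integral_indep:
  fixes h :: "'a \<Rightarrow> real"
  assumes indep: "indep_set (sets G) (sets H)" and G: "subalgebra M G" and H: "subalgebra M H"
    and A: "A \<in> sets G" and h: "h \<in> borel_measurable H" "integrable M h"
  shows "(LINT x:A|M. h x) = prob A * (\<integral>x. h x \<partial>M)"
proof -
  have [measurable]: "A \<in> events" using indep A by (auto simp: indep_sets2_eq)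
  have sub: "sigma_sets (space M) {f -` B \<inter> space M |B. B \<in> sets borel} \<subseteq> sets K"
    if "f \<in> borel_measurable K" "subalgebra M K" for f :: "'a \<Rightarrow> real" and K
    using that sets.sigma_sets_subset[of "{f -` B \<inter> space M |B. B \<in> sets borel}" K]
      measurable_sets[OF that(1)] by (auto simp: subalgebra_def)
  have "indep_var borel (indicator A) borel h"
    unfolding indep_var_eq
  proof (intro conjI)
    show "indep_set (sigma_sets (space M) {(indicator A :: 'a \<Rightarrow> real) -` B \<inter> space M |B. B \<in> sets borel})
        (sigma_sets (space M) {h -` B \<inter> space M |B. B \<in> sets borel})"
      using indep sub[of "indicator A" G] sub[of h H] G H A h(1)
      unfolding indep_sets2_eq by (meson borel_measurable_indicator order_trans subsetD)
  qed (use h H in \<open>auto intro: measurable_from_subalg\<close>)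
  from indep_var_lebesgue_integral[OF this] h show ?thesis
    by (simp add: set_lebesgue_integral_def emeasure_eq_measure)
qed

context resampling
begin

text \<open>The right-hand side is \<open>\<F> (k - 1)\<close>-measurable, so this says
  \<open>E[Z\<^sub>k | \<F>\<^sub>k] = E[Z | \<F>\<^sub>k\<^sub>-\<^sub>1]\<close>.\<close>

lemma set_integral_Zr:
  assumes k: "k \<in> {1..n}" and A: "A \<in> sets (\<F> k)"
  shows "(LINT \<omega>:A|M. Zr k \<omega>) = (LINT \<omega>:A|M. real_cond_exp M (\<F> (k - 1)) Z \<omega>)"
proof -
  let ?V = "real_cond_exp M (\<F> (k - 1)) Z"
  let ?R = "generated_sigma M S (ext k) ({0..n} - {k})"
  let ?K = "generated_sigma M S X {k}"
  \<comment> \<open>\<open>\<F> k\<close> is generated by the past together with \<open>X k\<close>;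
    these intersections form a generating system stable under intersection.\<close>
  let ?G = "{B \<inter> C | B C. B \<in> sets (\<F> (k - 1)) \<and> C \<in> sets ?K}"
  have k1: "k - 1 \<le> n" using k by auto
  interpret past: sigma_finite_subalgebra M "\<F> (k - 1)" by (rule sigma_finite_\<F>[OF k1])
  have K: "subalgebra M ?K" using k X by (intro subalgebra_generated_sigma) auto
  have sets_past: "sets (\<F> (k - 1)) \<subseteq> events" and sets_K: "sets ?K \<subseteq> events"
    using past.subalg K by (auto simp: subalgebra_def)
  have int_V: "integrable M ?V" using integrable_Z by (rule past.real_cond_exp_int(1))
  have V_rest: "?V \<in> borel_measurable ?R"
    by (rule measurable_from_subalg[OF subalgebra_rest(2)[OF k] borel_measurable_cond_exp])
  \<comment> \<open>Both \<open>Zr k\<close> and \<open>?V\<close> are measurable with respect to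
    \<open>?R\<close>, which is independent of \<open>X k\<close>. Pulling out \<open>prob C\<close>
    reduces the identity to past events, where \<open>set_integral_Zr_past\<close> and the
    definition of conditional expectation settle it.\<close>
  have factor: "(LINT \<omega>:B \<inter> C|M. h \<omega>) = prob C * (LINT \<omega>:B|M. h \<omega>)"
    if B: "B \<in> sets (\<F> (k - 1))" and C: "C \<in> sets ?K"
      and h: "integrable M h" "h \<in> borel_measurable ?R" for B C h
  proof -
    have "B \<in> sets ?R" using subalgebra_rest(2)[OF k] B by (auto simp: subalgebra_def)
    then have "(\<lambda>\<omega>. indicator B \<omega> * h \<omega>) \<in> borel_measurable ?R"
      using h by (intro borel_measurable_times borel_measurable_indicator)
    moreover have "integrable M (\<lambda>\<omega>. indicator B \<omega> * h \<omega>)"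
      using integrable_mult_indicator[of B M h] B sets_past h by auto
    ultimately have "(LINT \<omega>:C|M. indicator B \<omega> * h \<omega>) = prob C * (\<integral>\<omega>. indicator B \<omega> * h \<omega> \<partial>M)"
      by (intro set_integral_indep[OF indep_present_rest[OF k] K subalgebra_rest(1)[OF k] C])
    then show ?thesis
      by (simp add: set_lebesgue_integral_def indicator_inter_arith ac_simps)
  qed
  show ?thesis
  proof (rule set_integral_eq_on_sigma_sets[where G="?G"])
    show "Int_stable ?G"
    proof (rule Int_stableI)
      fix a b assume "a \<in> ?G" "b \<in> ?G"
      then obtain B C B' C' where "a = B \<inter> C" "b = B' \<inter> C'"
        "B \<in> sets (\<F> (k - 1))" "C \<in> sets ?K" "B' \<in> sets (\<F> (k - 1))" "C' \<in> sets ?K" by auto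
      then show "a \<inter> b \<in> ?G"
        by (intro CollectI exI[of _ "B \<inter> B'"] exI[of _ "C \<inter> C'"]) auto
    qed
    show "?G \<subseteq> events" using sets_past sets_K by auto
    have top: "space M \<in> sets (\<F> (k - 1))" "space M \<in> sets ?K"
      using sets.top[of "\<F> (k - 1)"] sets.top[of ?K] by simp_all
    then show "space M \<in> ?G" by blast
    show "(LINT \<omega>:D|M. Zr k \<omega>) = (LINT \<omega>:D|M. ?V \<omega>)" if "D \<in> ?G" for D
    proof -
      from that obtain B C where D: "D = B \<inter> C" and B: "B \<in> sets (\<F> (k - 1))" and C: "C \<in> sets ?K"
        by auto
      have "(LINT \<omega>:B|M. Zr k \<omega>) = (LINT \<omega>:B|M. ?V \<omega>)"
        using set_integral_Zr_past[OF k B] past.real_cond_exp_intA[OF integrable_Z B] by simp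
      then show ?thesis
        unfolding D factor[OF B C integrable_Zr[OF k] measurable_Zr_rest[OF k]]
          factor[OF B C int_V V_rest] by simp
    qed
    have "X j -` U \<inter> space M \<in> ?G" if j: "j \<in> {1..k}" and U: "U \<in> sets S" for j U
    proof (cases "j = k")
      case True
      then have "X j -` U \<inter> space M \<in> sets ?K" using U by (intro vimage_in_generated_sigma) auto
      moreover have "X j -` U \<inter> space M = space M \<inter> (X j -` U \<inter> space M)" by auto
      ultimately show ?thesis using top by blast
    next
      case False
      then have "X j -` U \<inter> space M \<in> sets (\<F> (k - 1))"
        using U j by (intro vimage_in_generated_sigma) auto
      moreover have "X j -` U \<inter> space M = (X j -` U \<inter> space M) \<inter> space M" by auto
      ultimately show ?thesis using top by blast
    qed
    then have "(\<Union>j\<in>{1..k}. {X j -` U \<inter> space M | U. U \<in> sets S}) \<subseteq> ?G"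
      by blast
    then have "sets (\<F> k) \<subseteq> sigma_sets (space M) ?G"
      unfolding sets_generated_sigma by (rule sigma_sets_mono')
    then show "A \<in> sigma_sets (space M) ?G" using A by auto
  qed (rule integrable_Zr[OF k] int_V)+
qed

definition D where
  "D k \<omega> = real_cond_exp M (\<F> k) Z \<omega> - real_cond_exp M (\<F> (k - 1)) Z \<omega>"

lemma integrable_cond_exp: "k \<le> n \<Longrightarrow> integrable M (real_cond_exp M (\<F> k) Z)"
  using sigma_finite_subalgebra.real_cond_exp_int(1)[OF sigma_finite_\<F> integrable_Z] .

lemma integrable_D: "k \<in> {1..n} \<Longrightarrow> integrable M (D k)"
  unfolding D_def[abs_def] by (intro Bochner_Integration.integrable_diff integrable_cond_exp) auto

lemma measurable_D: "D k \<in> borel_measurable (\<F> k)"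
proof -
  have "subalgebra (\<F> k) (\<F> (k - 1))"
    unfolding subalgebra_def using sets_\<F>_mono[of "k - 1" k] by simp
  from measurable_from_subalg[OF this borel_measurable_cond_exp[of M _ Z]] show ?thesis
    unfolding D_def[abs_def] by (intro borel_measurable_diff borel_measurable_cond_exp)
qed

lemma set_integral_D:
  assumes k: "k \<in> {1..n}" and A: "A \<in> sets (\<F> k)"
  shows "(LINT \<omega>:A|M. D k \<omega>) = (LINT \<omega>:A|M. Z \<omega> - Zr k \<omega>)"
proof -
  have kn: "k \<le> n" "k - 1 \<le> n" using k by auto
  interpret now: sigma_finite_subalgebra M "\<F> k" by (rule sigma_finite_\<F>[OF kn(1)])
  have AM: "A \<in> events" using now.subalg A by (auto simp: subalgebra_def)
  have "(LINT \<omega>:A|M. D k \<omega>) = (LINT \<omega>:A|M. real_cond_exp M (\<F> k) Z \<omega>)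
      - (LINT \<omega>:A|M. real_cond_exp M (\<F> (k - 1)) Z \<omega>)"
    unfolding D_def
    by (intro set_integral_diff(2) integrable_imp_set_integrable integrable_cond_exp kn AM)
  also have "\<dots> = (LINT \<omega>:A|M. Z \<omega>) - (LINT \<omega>:A|M. Zr k \<omega>)"
    using now.real_cond_exp_intA[OF integrable_Z A] set_integral_Zr[OF k A] by simp
  also have "\<dots> = (LINT \<omega>:A|M. Z \<omega> - Zr k \<omega>)"
    by (intro set_integral_diff(2)[symmetric] integrable_imp_set_integrable integrable_Z
        integrable_Zr[OF k] AM)
  finally show ?thesis .
qed

text \<open>The martingale property, in integrated form. It later converts the bound on lower tails
  into one on upper tails.\<close>

lemma set_integral_D_past:
  assumes k: "k \<in> {1..n}" and B: "B \<in> sets (\<F> (k - 1))"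
  shows "(LINT \<omega>:B|M. D k \<omega>) = 0"
proof -
  have "k - 1 \<le> n" using k by auto
  from subalgebra_\<F>[OF this] B have "B \<in> events" by (auto simp: subalgebra_def)
  moreover have "B \<in> sets (\<F> k)" using sets_\<F>_mono[of "k - 1" k] B by auto
  ultimately show ?thesis
    using set_integral_D[OF k] set_integral_Zr_past[OF k B] integrable_Z integrable_Zr[OF k]
    by (simp add: set_integral_diff(2) integrable_imp_set_integrable)
qed

end

section \<open>Comparison of the martingale with the independent sum\<close>

lemma integral_nonneg_if_truncations:
  fixes g :: "'b \<Rightarrow> real"
  assumes g: "integrable L g" and "prob_space L"
    and nonneg: "\<And>t. 0 \<le> (\<integral>y. max (g y) t \<partial>L)"
  shows "0 \<le> (\<integral>y. g y \<partial>L)"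
proof -
  interpret prob_space L by fact
  have [measurable]: "g \<in> borel_measurable L" using g by auto
  have "(\<lambda>i. \<integral>y. max (g y) (- real i) \<partial>L) \<longlonglongrightarrow> (\<integral>y. g y \<partial>L)"
  proof (rule integral_dominated_convergence)
    show "integrable L (\<lambda>y. \<bar>g y\<bar>)" using g by simp
    show "AE y in L. (\<lambda>i. max (g y) (- real i)) \<longlonglongrightarrow> g y"
    proof (rule AE_I2)
      fix y
      obtain N where "- g y < real N" using reals_Archimedean2 by blast
      then have "eventually (\<lambda>i. max (g y) (- real i) = g y) sequentially"
        by (intro eventually_sequentiallyI[of N]) auto
      then show "(\<lambda>i. max (g y) (- real i)) \<longlonglongrightarrow> g y" by (rule tendsto_eventually)
    qed
    show "AE y in L. norm (max (g y) (- real i)) \<le> \<bar>g y\<bar>" for i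
      by (rule AE_I2) auto
  qed measurable
  then show ?thesis using nonneg by (intro LIMSEQ_le_const) auto
qed

text \<open>Since -t = E(f - t) is at most E max(f - t, 0), the comparison gives E max(g, t) \<ge> 0
  for every \<open>t\<close>; letting \<open>t\<close> tend to -\<infinity> recovers the mean of
  \<open>g\<close>.\<close>

lemma mean_nonneg_if_stop_loss_ge:
  fixes f :: "'a \<Rightarrow> real" and g :: "'b \<Rightarrow> real"
  assumes "prob_space M" "prob_space L" and f: "integrable M f" "(\<integral>x. f x \<partial>M) = 0" and g: "integrable L g"
    and le: "\<And>t. (\<integral>x. max (f x - t) 0 \<partial>M) \<le> (\<integral>y. max (g y - t) 0 \<partial>L)"
  shows "0 \<le> (\<integral>y. g y \<partial>L)"
proof (rule integral_nonneg_if_truncations[OF g assms(2)])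
  fix t
  interpret M: prob_space M by fact
  interpret L: prob_space L by fact
  have "- t = (\<integral>x. f x - t \<partial>M)" using f by (simp add: M.prob_space)
  also have "\<dots> \<le> (\<integral>x. max (f x - t) 0 \<partial>M)" using f by (intro integral_mono) auto
  also have "\<dots> \<le> (\<integral>y. max (g y - t) 0 \<partial>L)" by (rule le)
  also have "\<dots> = (\<integral>y. max (g y) t - t \<partial>L)"
    by (intro Bochner_Integration.integral_cong) auto
  also have "\<dots> = (\<integral>y. max (g y) t \<partial>L) - t" using g by (simp add: L.prob_space)
  finally show "0 \<le> (\<integral>y. max (g y) t \<partial>L)" by simp
qed

text \<open>The joint law is a product, so \<open>\<eta>\<close> can be integrated out first with
  \<open>A\<close> held fixed.\<close>

lemma stop_loss_indep:
  assumes "prob_space P" and indep: "prob_space.indep_var P borel \<eta> borel A"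
    and L: "distr P borel \<eta> = L" "integrable L (\<lambda>x. x)" and A: "integrable P A"
  shows "(\<integral>\<omega>. max (A \<omega> + \<eta> \<omega> - t) 0 \<partial>P) = (\<integral>\<omega>. stop_loss L (t - A \<omega>) \<partial>P)"
proof -
  interpret P: prob_space P by fact
  have [measurable]: "\<eta> \<in> borel_measurable P" "A \<in> borel_measurable P"
    using indep unfolding P.indep_var_distribution_eq by blast+
  have pair: "L \<Otimes>\<^sub>M distr P borel A = distr P (borel \<Otimes>\<^sub>M borel) (\<lambda>\<omega>. (\<eta> \<omega>, A \<omega>))"
    using indep unfolding P.indep_var_distribution_eq L(1) by blast
  let ?K = "distr P borel A"
  interpret L: prob_space L unfolding L(1)[symmetric] by (rule P.prob_space_distr) simp
  interpret K: prob_space ?K by (rule P.prob_space_distr) simp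
  interpret pair_sigma_finite L ?K ..
  have "integrable ?K (\<lambda>x. x)" using A by (simp add: integrable_distr_eq)
  from integrable_pair_posp[OF L.prob_space_axioms K.prob_space_axioms L(2) this]
  have int: "integrable (L \<Otimes>\<^sub>M ?K) (\<lambda>(y, a). max (y + a - t) 0)" .
  have [measurable_cong]: "sets L = sets borel" unfolding L(1)[symmetric] by simp
  have "(\<integral>\<omega>. max (A \<omega> + \<eta> \<omega> - t) 0 \<partial>P) = (\<integral>z. (case z of (y, a) \<Rightarrow> max (y + a - t) 0) \<partial>(L \<Otimes>\<^sub>M ?K))"
    unfolding pair by (subst integral_distr) (auto simp: ac_simps)
  also have "\<dots> = (\<integral>a. (\<integral>y. max (y + a - t) 0 \<partial>L) \<partial>?K)"
    using int by (rule integral_snd[symmetric])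
  also have "\<dots> = (\<integral>\<omega>. (\<integral>y. max (y + A \<omega> - t) 0 \<partial>L) \<partial>P)"
    by (intro integral_distr) measurable
  finally show ?thesis by (simp add: stop_loss_def algebra_simps)
qed

text \<open>After \<open>stop_loss_sum\<close>, the hypothesis applies under the integral over
  \<open>y\<close> at the level \<open>t - y\<close>. The variables \<open>A\<close> and
  \<open>B\<close> may live on different spaces.\<close>

lemma stop_loss_sum_mono:
  assumes L: "prob_space L" "sets L = sets borel" "integrable L (\<lambda>x. x)"
    and M: "prob_space M" "integrable M A" and P: "prob_space P" "integrable P B"
    and le: "\<And>t. (\<integral>\<omega>. max (A \<omega> - t) 0 \<partial>M) \<le> (\<integral>\<omega>. max (B \<omega> - t) 0 \<partial>P)"
  shows "(\<integral>\<omega>. stop_loss L (t - A \<omega>) \<partial>M) \<le> (\<integral>\<omega>. stop_loss L (t - B \<omega>) \<partial>P)"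
proof -
  have int: "integrable L (\<lambda>y. \<integral>\<omega>. max (A \<omega> - (t - y)) 0 \<partial>M)"
    if M: "prob_space M" "integrable M A" for M and A :: "'c \<Rightarrow> real"
  proof -
    interpret M: prob_space M by fact
    interpret L: prob_space L by fact
    interpret pair_prob_space M L ..
    have "integrable (M \<Otimes>\<^sub>M L) (\<lambda>(\<omega>, y). max (A \<omega> - (t - y)) 0)"
      using integrable_pair_posp[OF M(1) L(1) M(2) L(3), of t] by (simp add: algebra_simps)
    then show ?thesis by (rule integrable_snd)
  qed
  show ?thesis
    unfolding stop_loss_sum[OF L M] stop_loss_sum[OF L P]
    by (intro integral_mono int M P le)
qed

section \<open>One martingale step and the induction over all steps\<close>

context resampling
begin

lemma set_integral_cond_exp_le:
  assumes k: "k \<in> {1..n}" and B: "B \<in> sets (\<F> (k - 1))" and f: "integrable M f"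
    and le: "AE \<omega> in M. real_cond_exp M (\<F> (k - 1)) f \<omega> \<le> c"
  shows "(LINT \<omega>:B|M. f \<omega>) \<le> prob B * c"
proof -
  have "k - 1 \<le> n" using k by auto
  interpret past: sigma_finite_subalgebra M "\<F> (k - 1)" by (rule sigma_finite_\<F>) fact
  have BM: "B \<in> events" using past.subalg B by (auto simp: subalgebra_def)
  have "(LINT \<omega>:B|M. f \<omega>) = (LINT \<omega>:B|M. real_cond_exp M (\<F> (k - 1)) f \<omega>)"
    by (rule past.real_cond_exp_intA[OF f B])
  also have "\<dots> \<le> (LINT \<omega>:B|M. c)"
    using le by (intro set_integral_mono_AE integrable_imp_set_integrable BM past.real_cond_exp_int f) auto
  finally show ?thesis using set_integral_const[OF BM] by simp
qed

context
  fixes k :: nat and \<mu> \<nu> :: "real measure"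
  assumes k: "k \<in> {1..n}"
    and \<mu>: "real_distribution \<mu>" "integrable \<mu> (\<lambda>x. x)"
    and \<nu>: "real_distribution \<nu>" "integrable \<nu> (\<lambda>x. x)"
    and cdf_le: "\<And>x. cdf \<nu> x \<le> cdf \<mu> x"
    and upper: "\<And>t. AE \<omega> in M. real_cond_exp M (\<F> (k - 1)) (\<lambda>\<omega>. max (Z \<omega> - Zr k \<omega> - t) 0) \<omega>
                   \<le> (\<integral>y. max (y - t) 0 \<partial>\<nu>)"
    and lower: "\<And>t. AE \<omega> in M. real_cond_exp M (\<F> (k - 1)) (\<lambda>\<omega>. max (t - (Z \<omega> - Zr k \<omega>)) 0) \<omega>
                   \<le> (\<integral>y. max (t - y) 0 \<partial>\<mu>)"
begin

interpretation \<mu>: real_distribution \<mu> by (rule \<mu>)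
interpretation \<nu>: real_distribution \<nu> by (rule \<nu>)

lemma integrable_diff: "integrable M (\<lambda>\<omega>. Z \<omega> - Zr k \<omega>)"
  using integrable_Z integrable_Zr[OF k] by auto

lemma set_integral_upper:
  assumes B: "B \<in> sets (\<F> (k - 1))"
  shows "(LINT \<omega>:B|M. max (Z \<omega> - Zr k \<omega> - t) 0) \<le> prob B * (\<integral>y. max (y - t) 0 \<partial>\<nu>)"
  using integrable_diff by (intro set_integral_cond_exp_le[OF k B _ upper]) auto

lemma set_integral_lower:
  assumes B: "B \<in> sets (\<F> (k - 1))"
  shows "(LINT \<omega>:B|M. max (t - (Z \<omega> - Zr k \<omega>)) 0) \<le> prob B * (\<integral>y. max (t - y) 0 \<partial>\<mu>)"
  using integrable_diff by (intro set_integral_cond_exp_le[OF k B _ lower]) auto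

text \<open>\<open>Z - Zr k\<close> has mean zero. The two conditional bounds, integrated over the
  whole space, therefore force the signs of the means of \<nu> and \<mu>.\<close>

lemma stoch_pair: "stoch_pair \<mu> \<nu>"
proof -
  have top: "space M \<in> sets (\<F> j)" for j
    using sets.top[of "\<F> j"] by simp
  have mean: "(\<integral>\<omega>. Z \<omega> - Zr k \<omega> \<partial>M) = 0"
    using set_integral_D[OF k top] set_integral_D_past[OF k top] integrable_diff
    by (simp add: set_integral_space)
  have "0 \<le> (\<integral>y. y \<partial>\<nu>)"
  proof (rule mean_nonneg_if_stop_loss_ge[OF prob_space_axioms \<nu>.prob_space_axioms integrable_diff mean \<nu>(2)])
    fix t
    show "(\<integral>\<omega>. max (Z \<omega> - Zr k \<omega> - t) 0 \<partial>M) \<le> (\<integral>y. max (y - t) 0 \<partial>\<nu>)"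
      using set_integral_upper[OF top, of t] integrable_diff by (simp add: set_integral_space prob_space)
  qed
  \<comment> \<open>The same argument for the negated variables; the bound on lower tails at level
    \<open>- t\<close> is the one on upper tails at level \<open>t\<close>.\<close>
  moreover have "0 \<le> (\<integral>y. - y \<partial>\<mu>)"
  proof (rule mean_nonneg_if_stop_loss_ge[where f="\<lambda>\<omega>. - (Z \<omega> - Zr k \<omega>)", OF prob_space_axioms \<mu>.prob_space_axioms])
    fix t
    show "(\<integral>\<omega>. max (- (Z \<omega> - Zr k \<omega>) - t) 0 \<partial>M) \<le> (\<integral>y. max (- y - t) 0 \<partial>\<mu>)"
    proof -
      have eq: "- (Z \<omega> - Zr k \<omega>) - t = - t - (Z \<omega> - Zr k \<omega>)" "- y - t = - t - y" for \<omega> and y :: real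
        by simp_all
      have "integrable M (\<lambda>\<omega>. max (- t - (Z \<omega> - Zr k \<omega>)) 0)" using integrable_diff by auto
      from set_integral_lower[OF top, of "- t", unfolded set_integral_space[OF this]] show ?thesis
        unfolding eq by (simp only: prob_space mult_1)
    qed
    show "(\<integral>\<omega>. - (Z \<omega> - Zr k \<omega>) \<partial>M) = 0" using mean integral_minus[of M "\<lambda>\<omega>. Z \<omega> - Zr k \<omega>"] by simp
  qed (intro integrable_minus integrable_diff \<mu>(2))+
  ultimately show ?thesis
    by (intro stoch_pair.intro stoch_pair_axioms.intro \<mu> \<nu> cdf_le) simp_all
qed

text \<open>For an event \<open>B\<close> of positive probability, \<open>h s / prob B\<close> is
  the integrated tail of \<open>D k\<close> conditioned on \<open>B\<close>. It satisfies the
  hypotheses of \<open>convex_le_xi_law\<close>, and this elementary conditioning is all that is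
  required.\<close>

lemma set_integral_D_le_stop_loss:
  assumes B: "B \<in> sets (\<F> (k - 1))"
  shows "(LINT \<omega>:B|M. max (D k \<omega> - s) 0) \<le> prob B * stop_loss (xi_law \<mu> \<nu>) s"
proof -
  interpret stoch_pair \<mu> \<nu> by (rule stoch_pair)
  have kn: "k \<le> n" using k by auto
  have B': "B \<in> sets (\<F> k)" using sets_\<F>_mono[of "k - 1" k] B by auto
  have BM: "B \<in> events" using subalgebra_\<F>[OF kn] B' by (auto simp: subalgebra_def)
  have D: "integrable M (D k)" by (rule integrable_D[OF k])
  define h where "h s = (LINT \<omega>:B|M. max (D k \<omega> - s) 0)" for s
  have int: "set_integrable M B (\<lambda>\<omega>. max (D k \<omega> - s) 0)" "set_integrable M B (\<lambda>\<omega>. s)"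
    "set_integrable M B (D k)" for s
    using D BM by (intro integrable_imp_set_integrable; auto)+
  have up: "h s \<le> prob B * (\<integral>y. max (y - s) 0 \<partial>\<nu>)" for s
    unfolding h_def
    using set_integral_posp_le[OF subalgebra_\<F>[OF kn] finite_measure_axioms measurable_D D integrable_diff
        set_integral_D[OF k] B'] set_integral_upper[OF B]
    by (rule order_trans)
  \<comment> \<open>Because \<open>D k\<close> integrates to zero over \<open>B\<close>, adding
    \<open>prob B * s\<close> turns the upper tail into the lower one, to which conditional Jensen
    and the bound by \<mu> apply.\<close>
  have low: "h s + prob B * s \<le> prob B * (\<integral>y. max (s - y) 0 \<partial>\<mu>)" for s
  proof -
    have "h s + prob B * s = h s - (LINT \<omega>:B|M. D k \<omega>) + (LINT \<omega>:B|M. s)"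
      using set_integral_D_past[OF k B] set_integral_const[OF BM] by simp
    also have "\<dots> = (LINT \<omega>:B|M. max (D k \<omega> - s) 0 - D k \<omega> + s)"
      unfolding h_def set_integral_add(2)[OF set_integral_diff(1)[OF int(1,3)] int(2)]
        set_integral_diff(2)[OF int(1,3)] ..
    also have "\<dots> = (LINT \<omega>:B|M. max (s - D k \<omega>) 0)"
      by (intro set_lebesgue_integral_cong BM) auto
    also have "\<dots> \<le> prob B * (\<integral>y. max (s - y) 0 \<partial>\<mu>)"
      using set_integral_negp_le[OF subalgebra_\<F>[OF kn] finite_measure_axioms measurable_D D integrable_diff
          set_integral_D[OF k] B'] set_integral_lower[OF B]
      by (rule order_trans)
    finally show ?thesis .
  qed
  \<comment> \<open>Convexity is inherited from the positive part, pointwise in \<omega>.\<close>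
  have conv: "h ((1 - l) * x + l * y) \<le> (1 - l) * h x + l * h y" if l: "0 \<le> l" "l \<le> 1" for l x y
  proof -
    have "h ((1 - l) * x + l * y) \<le> (LINT \<omega>:B|M. (1 - l) * max (D k \<omega> - x) 0 + l * max (D k \<omega> - y) 0)"
      unfolding h_def
    proof (intro set_integral_mono int(1) set_integral_add(1) set_integrable_mult_right)
      fix \<omega>
      have "D k \<omega> - ((1 - l) * x + l * y) = (1 - l) * (D k \<omega> - x) + l * (D k \<omega> - y)"
        by (simp add: algebra_simps)
      also have "\<dots> \<le> (1 - l) * max (D k \<omega> - x) 0 + l * max (D k \<omega> - y) 0"
        using l by (intro add_mono mult_left_mono) auto
      finally show "max (D k \<omega> - ((1 - l) * x + l * y)) 0
          \<le> (1 - l) * max (D k \<omega> - x) 0 + l * max (D k \<omega> - y) 0"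
        using l by simp
    qed
    also have "\<dots> = (1 - l) * h x + l * h y"
      unfolding h_def using int(1)
      by (subst set_integral_add(2)) auto
    finally show ?thesis .
  qed
  show ?thesis
  proof (cases "prob B = 0")
    case True
    then have "h s \<le> 0" using up[of s] by simp
    then show ?thesis using True by (simp add: h_def)
  next
    case False
    then have pos: "0 < prob B" using measure_nonneg[of M B] by linarith
    have "h s / prob B \<le> (\<integral>y. max (y - s) 0 \<partial>xi_law \<mu> \<nu>)"
    proof (rule convex_le_xi_law[where f="\<lambda>s. h s / prob B"])
      show "convex_on UNIV (\<lambda>s. h s / prob B)"
      proof (rule convex_onI)
        fix l x y :: real assume l: "0 < l" "l < 1"
        have "h ((1 - l) * x + l * y) / prob B \<le> ((1 - l) * h x + l * h y) / prob B"
          using conv[of l x y] l pos by (intro divide_right_mono) auto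
        then show "h ((1 - l) *\<^sub>R x + l *\<^sub>R y) / prob B \<le> (1 - l) * (h x / prob B) + l * (h y / prob B)"
          by (simp add: add_divide_distrib)
      qed simp
      show "h s / prob B \<le> (\<integral>y. max (y - s) 0 \<partial>\<nu>)" for s
        using up[of s] pos by (simp add: divide_le_eq mult.commute)
      show "h s / prob B + s \<le> (\<integral>y. max (s - y) 0 \<partial>\<mu>)" for s
        using low[of s] pos by (simp add: field_simps)
    qed
    then show ?thesis using pos by (simp add: stop_loss_def h_def divide_le_eq mult.commute)
  qed
qed

end

lemma cond_exp_0: "AE \<omega> in M. real_cond_exp M (\<F> 0) Z \<omega> = expectation Z"
proof -
  interpret sigma_finite_subalgebra M "\<F> 0" by (rule sigma_finite_\<F>) simp
  have "sets (\<F> 0) = {{}, space M}"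
    by (simp add: sets_generated_sigma sigma_sets_empty_eq)
  then show ?thesis
    using integrable_Z
    by (intro real_cond_exp_charact)
       (auto simp: set_integral_space prob_space set_lebesgue_integral_def[of _ "{}"])
qed

lemma cond_exp_n: "AE \<omega> in M. real_cond_exp M (\<F> n) Z \<omega> = Z \<omega>"
proof -
  interpret sigma_finite_subalgebra M "\<F> n" by (rule sigma_finite_\<F>) simp
  have "Z \<in> borel_measurable (\<F> n)"
    unfolding Z_def[abs_def]
    by (rule measurable_compose[OF measurable_restrict_generated_sigma F]) (rule X)
  with integrable_Z show ?thesis by (rule real_cond_exp_F_meas)
qed

text \<open>Each step makes two exchanges. Given the past, \<open>D (Suc k)\<close> gives way to the
  law of \<open>\<xi> (Suc k)\<close> at a random level; then the induction hypothesis replaces the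
  earlier martingale value by the partial sum. In between, the new variable is present only through
  its \<open>stop_loss\<close> function, which bridges the two spaces.\<close>

lemma stop_loss_martingale_le:
  fixes P :: "'e measure" and \<xi> :: "nat \<Rightarrow> 'e \<Rightarrow> real"
  assumes P: "prob_space P" "prob_space.indep_vars P (\<lambda>_. borel) \<xi> {1..n}"
    and int_\<xi>: "\<And>i. i \<in> {1..n} \<Longrightarrow> integrable P (\<xi> i)"
    and le: "\<And>i B s. i \<in> {1..n} \<Longrightarrow> B \<in> sets (\<F> (i - 1)) \<Longrightarrow>
         (LINT \<omega>:B|M. max (D i \<omega> - s) 0) \<le> prob B * stop_loss (distr P borel (\<xi> i)) s"
    and "k \<le> n"
  shows "(\<integral>\<omega>. max (real_cond_exp M (\<F> k) Z \<omega> - expectation Z - t) 0 \<partial>M)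
           \<le> (\<integral>\<omega>. max ((\<Sum>i=1..k. \<xi> i \<omega>) - t) 0 \<partial>P)"
  using \<open>k \<le> n\<close>
\<comment> \<open>The induction hypothesis is used at all levels at once, since
  \<open>\<xi> (Suc k)\<close> shifts \<open>t\<close>.\<close>
proof (induction k arbitrary: t)
  case 0
  interpret P: prob_space P by (rule P)
  have "(\<integral>\<omega>. max (real_cond_exp M (\<F> 0) Z \<omega> - expectation Z - t) 0 \<partial>M) = (\<integral>\<omega>. max (- t) 0 \<partial>M)"
    using cond_exp_0 integrable_cond_exp[of 0] by (intro integral_cong_AE) auto
  then show ?case by (simp add: prob_space P.prob_space)
next
  case (Suc k)
  interpret P: prob_space P by (rule P)
  let ?Y = "\<lambda>\<omega>. real_cond_exp M (\<F> k) Z \<omega> - expectation Z"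
  let ?S = "\<lambda>\<omega>. \<Sum>i=1..k. \<xi> i \<omega>"
  let ?L = "distr P borel (\<xi> (Suc k))"
  have k: "Suc k \<in> {1..n}" "k \<le> n" using Suc by auto
  have int_S: "integrable P ?S"
    using k by (intro Bochner_Integration.integrable_sum int_\<xi>) auto
  have int_Y: "integrable M ?Y" using integrable_cond_exp[OF k(2)] by auto
  have \<xi>_meas [measurable]: "\<xi> (Suc k) \<in> borel_measurable P" using int_\<xi>[OF k(1)] by auto
  have L: "prob_space ?L" "sets ?L = sets borel" "integrable ?L (\<lambda>x. x)"
    using int_\<xi>[OF k(1)] by (auto simp: integrable_distr_eq intro: P.prob_space_distr)
  have indep: "P.indep_var borel (\<xi> (Suc k)) borel ?S"
    by (rule P.indep_vars_sum) (use k in \<open>auto intro: P.indep_vars_subset[OF P(2)]\<close>)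
  have "(\<integral>\<omega>. max (real_cond_exp M (\<F> (Suc k)) Z \<omega> - expectation Z - t) 0 \<partial>M)
      = (\<integral>\<omega>. max (D (Suc k) \<omega> - (t - ?Y \<omega>)) 0 \<partial>M)"
    by (simp add: D_def algebra_simps)
  also have "\<dots> \<le> (\<integral>\<omega>. stop_loss ?L (t - ?Y \<omega>) \<partial>M)"
  proof (rule stop_loss_mixture[OF L(1,3) prob_space_axioms subalgebra_\<F>[OF k(2)]])
    show "(\<lambda>\<omega>. t - ?Y \<omega>) \<in> borel_measurable (\<F> k)"
      by (intro borel_measurable_diff borel_measurable_const borel_measurable_cond_exp)
    show "(LINT \<omega>:B|M. max (D (Suc k) \<omega> - s) 0) \<le> prob B * stop_loss ?L s" if "B \<in> sets (\<F> k)" for B s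
      using le[OF k(1), of B s] that by simp
  qed (use int_Y integrable_D[OF k(1)] in auto)
  also have "\<dots> \<le> (\<integral>\<omega>. stop_loss ?L (t - ?S \<omega>) \<partial>P)"
    by (rule stop_loss_sum_mono[OF L prob_space_axioms int_Y P(1) int_S]) (rule Suc.IH[OF k(2)])
  also have "\<dots> = (\<integral>\<omega>. max (?S \<omega> + \<xi> (Suc k) \<omega> - t) 0 \<partial>P)"
    by (rule stop_loss_indep[OF P(1) indep refl L(3) int_S, symmetric])
  finally show ?case by simp
qed

end

section \<open>Transfer to the laws of T and W, and the tail bound\<close>

lemma cdf_distr_le:
  assumes P: "prob_space P" "U \<in> borel_measurable P" and Q: "prob_space Q" "V \<in> borel_measurable Q"
    and le: "stoch_le P U Q V"
  shows "cdf (distr Q borel V) x \<le> cdf (distr P borel U) x"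
proof -
  have *: "cdf (distr K borel Y) x = 1 - measure K {\<omega>\<in>space K. Y \<omega> > x}"
    if K: "prob_space K" and Y [measurable]: "Y \<in> borel_measurable K" for K :: "'k measure" and Y
  proof -
    interpret prob_space K by fact
    have "cdf (distr K borel Y) x = prob {\<omega> \<in> space K. Y \<omega> \<le> x}"
      by (simp add: cdf_def2 measure_distr vimage_def Int_def conj_commute)
    also have "\<dots> = prob (space K - {\<omega>\<in>space K. Y \<omega> > x})"
      by (intro arg_cong[where f=prob]) auto
    also have "\<dots> = 1 - prob {\<omega>\<in>space K. Y \<omega> > x}" by (intro prob_compl) measurable
    finally show ?thesis .
  qed
  show ?thesis using le *[OF P] *[OF Q] by (simp add: stoch_le_def)
qed

text \<open>For \<open>l \<ge> 0\<close> the function \<open>max (1 + l * (u - x)) 0\<close>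
  dominates the indicator of \<open>u \<ge> x\<close>. For \<open>l = 0\<close> the right-hand side
  is 1.\<close>

lemma measure_ge_le_stop_loss:
  fixes U :: "'a \<Rightarrow> real" and V :: "'b \<Rightarrow> real"
  assumes "prob_space M" "prob_space P" and U: "integrable M U" and V: "integrable P V"
    and le: "\<And>t. (\<integral>\<omega>. max (U \<omega> - t) 0 \<partial>M) \<le> (\<integral>\<omega>. max (V \<omega> - t) 0 \<partial>P)" and l: "0 \<le> l"
  shows "measure M {\<omega>\<in>space M. U \<omega> \<ge> x} \<le> (\<integral>\<omega>. max (1 + l * (V \<omega> - x)) 0 \<partial>P)"
proof (cases "l = 0")
  case True
  interpret M: prob_space M by fact
  interpret P: prob_space P by fact
  show ?thesis using True by (simp add: P.prob_space)
next
  case False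
  then have l: "0 < l" using l by simp
  interpret M: prob_space M by fact
  have [measurable]: "U \<in> borel_measurable M" using U by auto
  \<comment> \<open>The level \<open>x - 1 / l\<close> is the zero of
    \<open>1 + l * (u - x)\<close>, so the majorant is a multiple of a single stop-loss
    payoff.\<close>
  have scale: "max (1 + l * (u - x)) 0 = l * max (u - (x - 1 / l)) 0" for u
    using l by (simp add: max_mult_distrib_left[symmetric] field_simps max_def)
  have int: "integrable M (\<lambda>\<omega>. max (1 + l * (U \<omega> - x)) 0)" using U by auto
  have "M.prob {\<omega>\<in>space M. U \<omega> \<ge> x} = (\<integral>\<omega>. indicator {\<omega>\<in>space M. U \<omega> \<ge> x} \<omega> \<partial>M)"
    by simp
  also have "\<dots> \<le> (\<integral>\<omega>. max (1 + l * (U \<omega> - x)) 0 \<partial>M)"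
  proof (rule integral_mono[OF _ int])
    show "integrable M (indicator {\<omega>\<in>space M. U \<omega> \<ge> x} :: 'a \<Rightarrow> real)"
      by (intro integrable_real_indicator) (auto simp: M.emeasure_eq_measure)
  qed (use l in \<open>auto simp: indicator_def\<close>)
  also have "\<dots> \<le> (\<integral>\<omega>. max (1 + l * (V \<omega> - x)) 0 \<partial>P)"
    unfolding scale using l by (simp add: le)
  finally show ?thesis .
qed

theorem corollary4p3:
  fixes M :: "'a measure" and S :: "'x measure" and n :: nat
    and X X' :: "nat \<Rightarrow> 'a \<Rightarrow> 'x" and F :: "(nat \<Rightarrow> 'x) \<Rightarrow> real"
    and Z :: "'a \<Rightarrow> real" and \<Delta> :: "nat \<Rightarrow> 'a \<Rightarrow> real"
    and Q :: "nat \<Rightarrow> 'c measure" and T :: "nat \<Rightarrow> 'c \<Rightarrow> real"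
    and R :: "nat \<Rightarrow> 'd measure" and W :: "nat \<Rightarrow> 'd \<Rightarrow> real"
    and P :: "'e measure" and \<xi> :: "nat \<Rightarrow> 'e \<Rightarrow> real"
  assumes "prob_space M"
    and "prob_space.indep_vars M (\<lambda>_. S) X {1..n}"
    and "F \<in> borel_measurable (PiM {1..n} (\<lambda>_. S))"
    and "\<And>\<omega>. Z \<omega> = F (\<lambda>j\<in>{1..n}. X j \<omega>)"
    and "integrable M Z"
    and "\<And>i. i \<in> {1..n} \<Longrightarrow> X' i \<in> measurable M S"
    and "\<And>i. i \<in> {1..n} \<Longrightarrow> distr M S (X' i) = distr M S (X i)"
    and "\<And>i. i \<in> {1..n} \<Longrightarrow>
           prob_space.indep_set M {X' i -` A \<inter> space M | A. A \<in> sets S}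
             (sets (generated_sigma M S X {1..n}))"
    and "\<And>i \<omega>. i \<in> {1..n} \<Longrightarrow>
           \<Delta> i \<omega> = Z \<omega> - F ((\<lambda>j\<in>{1..n}. X j \<omega>)(i := X' i \<omega>))"
    and "\<And>i. i \<in> {1..n} \<Longrightarrow> prob_space (Q i)"
    and "\<And>i. i \<in> {1..n} \<Longrightarrow> prob_space (R i)"
    and "\<And>i. i \<in> {1..n} \<Longrightarrow> integrable (Q i) (T i)"
    and "\<And>i. i \<in> {1..n} \<Longrightarrow> integrable (R i) (W i)"
    and "\<And>i. i \<in> {1..n} \<Longrightarrow> stoch_le (Q i) (T i) (R i) (W i)"
    and "\<And>i t. i \<in> {1..n} \<Longrightarrow>
           AE \<omega> in M. real_cond_exp M (generated_sigma M S X {1..i-1})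
                        (\<lambda>\<omega>. max (\<Delta> i \<omega> - t) 0) \<omega>
                      \<le> (\<integral>\<omega>'. max (W i \<omega>' - t) 0 \<partial>R i)"
    and "\<And>i t. i \<in> {1..n} \<Longrightarrow>
           AE \<omega> in M. real_cond_exp M (generated_sigma M S X {1..i-1})
                        (\<lambda>\<omega>. max (t - \<Delta> i \<omega>) 0) \<omega>
                      \<le> (\<integral>\<omega>'. max (t - T i \<omega>') 0 \<partial>Q i)"
    and "prob_space P"
    and "prob_space.indep_vars P (\<lambda>_. borel) \<xi> {1..n}"
    and "\<And>i. i \<in> {1..n} \<Longrightarrow>
           distr P borel (\<xi> i) = xi_law (distr (Q i) borel (T i)) (distr (R i) borel (W i))"
  shows "(\<forall>t. (\<integral>\<omega>. max (Z \<omega> - (\<integral>\<omega>'. Z \<omega>' \<partial>M) - t) 0 \<partial>M)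
              \<le> (\<integral>\<omega>. max ((\<Sum>i=1..n. \<xi> i \<omega>) - t) 0 \<partial>P)) \<and>
         (\<forall>x. measure M {\<omega>\<in>space M. Z \<omega> - (\<integral>\<omega>'. Z \<omega>' \<partial>M) \<ge> x}
              \<le> (INF l\<in>{0..}. \<integral>\<omega>. max (1 + l * ((\<Sum>i=1..n. \<xi> i \<omega>) - x)) 0 \<partial>P))"
proof -
  have Z_fun: "Z = (\<lambda>\<omega>. F (\<lambda>j\<in>{1..n}. X j \<omega>))" using assms(4) by auto
  interpret resampling M S n X X' F
    by (intro resampling.intro resampling_axioms.intro assms(1-3,6-8) assms(5)[unfolded Z_fun])
  let ?\<mu> = "\<lambda>i. distr (Q i) borel (T i)" and ?\<nu> = "\<lambda>i. distr (R i) borel (W i)"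
  \<comment> \<open>\<open>Z\<close> is the variable fixed in the statement; the constant of the
    locale is written out in full and identified with it.\<close>
  have Z_eq: "Z = resampling.Z n X F" using assms(4) by (simp add: fun_eq_iff Z_def)
  have \<Delta>_eq: "\<Delta> i = (\<lambda>\<omega>. resampling.Z n X F \<omega> - Zr i \<omega>)" if "i \<in> {1..n}" for i
    using assms(9)[OF that] by (simp add: fun_eq_iff Zr_def Z_eq)
  have T [measurable]: "T i \<in> borel_measurable (Q i)" and W [measurable]: "W i \<in> borel_measurable (R i)"
    if "i \<in> {1..n}" for i
    using assms(12,13)[OF that] by auto
  have laws: "real_distribution (?\<mu> i)" "integrable (?\<mu> i) (\<lambda>x. x)"
    "real_distribution (?\<nu> i)" "integrable (?\<nu> i) (\<lambda>x. x)"
    "\<And>x. cdf (?\<nu> i) x \<le> cdf (?\<mu> i) x"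
    if i: "i \<in> {1..n}" for i
    using assms(10-14)[OF i] T[OF i] W[OF i]
    by (auto simp: integrable_distr_eq intro: prob_space.real_distribution_distr cdf_distr_le)
  have upper: "AE \<omega> in M. real_cond_exp M (\<F> (i - 1)) (\<lambda>\<omega>. max (resampling.Z n X F \<omega> - Zr i \<omega> - t) 0) \<omega>
      \<le> (\<integral>y. max (y - t) 0 \<partial>?\<nu> i)" if i: "i \<in> {1..n}" for i t
    using assms(15)[OF i, of t] W[OF i] unfolding \<Delta>_eq[OF i] by (subst integral_distr) auto
  have lower: "AE \<omega> in M. real_cond_exp M (\<F> (i - 1)) (\<lambda>\<omega>. max (t - (resampling.Z n X F \<omega> - Zr i \<omega>)) 0) \<omega>
      \<le> (\<integral>y. max (t - y) 0 \<partial>?\<mu> i)" if i: "i \<in> {1..n}" for i t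
    using assms(16)[OF i, of t] T[OF i] unfolding \<Delta>_eq[OF i] by (subst integral_distr) auto
  \<comment> \<open>Integrability is a property of the law \<open>xi_law\<close>, inherited from T
    and W through the splice.\<close>
  have int_\<xi>: "integrable P (\<xi> i)" if i: "i \<in> {1..n}" for i
  proof -
    interpret stoch_pair "?\<mu> i" "?\<nu> i"
      by (rule stoch_pair[OF i laws[OF i] upper[OF i] lower[OF i]])
    have "\<xi> i \<in> borel_measurable P"
      using assms(17,18) i by (auto simp: prob_space.indep_vars_def2)
    from integrable_distr[OF this] show ?thesis
      using integrable_xi_law unfolding assms(19)[OF i, symmetric] by blast
  qed
  have le: "(LINT \<omega>:B|M. max (D i \<omega> - s) 0) \<le> prob B * stop_loss (distr P borel (\<xi> i)) s"
    if i: "i \<in> {1..n}" and B: "B \<in> sets (\<F> (i - 1))" for i B s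
    unfolding assms(19)[OF i]
    by (rule set_integral_D_le_stop_loss[OF i laws[OF i] upper[OF i] lower[OF i] B])
  have int_S: "integrable P (\<lambda>\<omega>. \<Sum>i=1..n. \<xi> i \<omega>)"
    by (intro Bochner_Integration.integrable_sum int_\<xi>)
  have int_Z: "integrable M (\<lambda>\<omega>. Z \<omega> - expectation Z)" using assms(5) by auto
  have main: "(\<integral>\<omega>. max (Z \<omega> - expectation Z - t) 0 \<partial>M) \<le> (\<integral>\<omega>. max ((\<Sum>i=1..n. \<xi> i \<omega>) - t) 0 \<partial>P)" for t
  proof -
    have "(\<integral>\<omega>. max (Z \<omega> - expectation Z - t) 0 \<partial>M)
        = (\<integral>\<omega>. max (real_cond_exp M (\<F> n) Z \<omega> - expectation Z - t) 0 \<partial>M)"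
      using cond_exp_n integrable_cond_exp[of n] integrable_Z unfolding Z_eq
      by (intro integral_cong_AE) auto
    also have "\<dots> \<le> (\<integral>\<omega>. max ((\<Sum>i=1..n. \<xi> i \<omega>) - t) 0 \<partial>P)"
      unfolding Z_eq by (rule stop_loss_martingale_le[OF assms(17,18) int_\<xi> le order_refl])
    finally show ?thesis .
  qed
  show ?thesis
  proof (intro conjI allI)
    fix x
    show "prob {\<omega>\<in>space M. Z \<omega> - expectation Z \<ge> x}
        \<le> (INF l\<in>{0..}. \<integral>\<omega>. max (1 + l * ((\<Sum>i=1..n. \<xi> i \<omega>) - x)) 0 \<partial>P)"
    proof (rule cINF_greatest)
      fix l :: real assume "l \<in> {0..}"
      then show "prob {\<omega>\<in>space M. Z \<omega> - expectation Z \<ge> x}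
          \<le> (\<integral>\<omega>. max (1 + l * ((\<Sum>i=1..n. \<xi> i \<omega>) - x)) 0 \<partial>P)"
        by (intro measure_ge_le_stop_loss[OF prob_space_axioms assms(17) int_Z int_S main]) simp
    qed simp
  qed (rule main)
qed

end
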